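(* Consider the space-time HDG method and the space-time EHDG method for the Navier--Stokes equations on a moving domain (the discrete problem, spaces and forms are defined in the context). Both methods are locally mass conserving. That is: for either method, for every $n\in\{0,\dots,N-1\}$ and every solution $(\boldsymbol{u}_h,\boldsymbol{p}_h)\in X_h^n$ of the discrete problem on the space-time slab $\mathcal{E}^n$, with $\boldsymbol{u}_h=(u_h,\bar u_h)$, the element velocity $u_h$ is exactly divergence-free, $$\nabla\cdot u_h = 0 \quad\text{for all } (t,x)\in\mathcal{K},\ \text{for all } \mathcal{K}\in\mathcal{T}^n,$$ and divergence-conforming, $$[\![u_h\cdot n]\!]=0 \ \text{ on every } S\in\mathcal{S}_I^n,\qquad u_h\cdot n=\bar u_h\cdot n\ \text{ on every } S\in\mathcal{S}_B^n .$$
   Context: **Domain and data.** $d\in\{2,3\}$, $\Omega(t)\subset\mathbb{R}^d$ is a domain depending continuously on $t\in[0,T]$, and $\mathcal{E}=\{(t,x): 0<t<T,\ x\in\Omega(t)\}\subset\mathbb{R}^{d+1}$. The boundary is partitioned without overlap as $\partial\mathcal{E}=\partial\mathcal{E}^D\cup\partial\mathcal{E}^N\cup\Omega(0)\cup\Omega(T)$ (Dirichlet part, Neumann part, bottom, top). $\nu>0$ is the viscosity, $f:\mathcal{E}\to\mathbb{R}^d$ a forcing term, $g:\partial\mathcal{E}^N\to\mathbb{R}^d$ boundary data, $u_0:\Omega(0)\to\mathbb{R}^d$ a divergence-free initial velocity. $\nabla$ and $\nabla\cdot$ are spatial operators. Unit space-time outward normals are written $(n_t,n)\in\mathbb{R}\times\mathbb{R}^d$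 (so the spatial part $n$ need not have unit length), and $\partial v/\partial n=(\nabla v)n$ with $(\nabla v)_{ij}=\partial_{x_j}v_i$. **Mesh.** $0=t^0<\dots<t^N=T$, $I^n=(t^n,t^{n+1})$, $\mathcal{E}^n=\{(t,x)\in\mathcal{E}:t\in I^n\}$, $\Omega^n=\Omega(t^n)$, $\partial\mathcal{E}^n=\{(t,x)\in\partial\mathcal{E}:t\in I^n\}$. $\mathcal{T}^n$ is a triangulation of $\mathcal{E}^n$ into non-overlapping $(d+1)$-simplices $\mathcal{K}$, with meshes matching at each $\Omega^n$ between consecutive slabs. Each $\mathcal{K}\in\mathcal{T}^n$ has at most one facet with $|n_t|=1$, called $K^n$ if $n_t=-1$ and $K^{n+1}$ if $n_t=1$ (an integral over a non-existing $K^n$ or $K^{n+1}$ is zero); $\mathcal{Q}^n_{\mathcal{K}}$ is the remaining part of $\partial\mathcal{K}$. $h_{\mathcal{K}}>0$ is the size of $\mathcal{K}$. $\mathcal{S}^n$ is the set of facets in the slab with $|n_t|\neq1$, $\Gamma^n$ their union, $\mathcal{S}^n_I$ the interior ones, $\mathcal{S}^n_B$ those on the boundary of $\mathcal{E}^n$. On an interior facet shared by $\mathcal{K}^\pm$, $[\![u_h\cdot n]\!]=u_h^+\cdot n^++u_h^-\cdot n^-$, where $\pm$ denotes traces and outward normals from $\mathcal{K}^\pm$. **Spaces.** For an integer $k\ge1$, with $P_l(D)$ the polynomials of degree at most $l$ on $D$: $V_h^n=\{v_h\in[L^2(\mathcal{E}^n)]^d: v_h|_{\mathcal{K}}\in[P_k(\mathcal{K})]^d\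 \forall\mathcal{K}\in\mathcal{T}^n\}$, $Q_h^n=\{q_h\in L^2(\mathcal{E}^n): q_h|_{\mathcal{K}}\in P_{k-1}(\mathcal{K})\ \forall\mathcal{K}\in\mathcal{T}^n\}$, $\bar V_h^n=\{\bar v_h\in[L^2(\Gamma^n)]^d:\bar v_h|_S\in[P_k(S)]^d\ \forall S\in\mathcal{S}^n,\ \bar v_h=0\text{ on }\partial\mathcal{E}^D\cap\partial\mathcal{E}^n\}$, $\bar Q_h^n=\{\bar q_h\in L^2(\Gamma^n):\bar q_h|_S\in P_k(S)\ \forall S\in\mathcal{S}^n\}$. The HDG method uses $X_h^{v,n}=V_h^n\times\bar V_h^n$, $X_h^{q,n}=Q_h^n\times\bar Q_h^n$. The EHDG method uses $X_h^{v,n}=V_h^n\times(\bar V_h^n\cap C(\Gamma^n))$, $X_h^{q,n}=Q_h^n\times\bar Q_h^n$. Set $X_h^n=X_h^{v,n}\times X_h^{q,n}$ and write $\boldsymbol{v}_h=(v_h,\bar v_h)$, $\boldsymbol{q}_h=(q_h,\bar q_h)$. **Discrete problem.** For $n=0,\dots,N-1$ successively, find $(\boldsymbol{u}_h,\boldsymbol{p}_h)\in X_h^n$ such that $$t_h^n(\boldsymbol{u}_h;\boldsymbol{u}_h,\boldsymbol{v}_h)+a_h^n(\boldsymbol{u}_h,\boldsymbol{v}_h)+b_h^n(\boldsymbol{p}_h,\boldsymbol{v}_h)=L_h^n(\boldsymbol{v}_h)\ \ \forall\boldsymbol{v}_h\in X_h^{v,n},\qquad b_h^n(\boldsymbol{q}_h,\boldsymbol{u}_h)=0\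 \ \forall\boldsymbol{q}_h\in X_h^{q,n},$$ where $$L_h^n(\boldsymbol{v})=\sum_{\mathcal{K}\in\mathcal{T}^n}\int_{\mathcal{K}}f\cdot v\,dx\,dt-\int_{\partial\mathcal{E}^N\cap\partial\mathcal{E}^n}g\cdot\bar v\,ds+\int_{\Omega^n}u_h^-\cdot v\,dx,$$ with $u_h^-=\lim_{\varepsilon\to0^+}u_h(t^n-\varepsilon)$ for $n>0$ (from the previous slab) and, for $n=0$, $u_h^-$ an exactly divergence-free projection of $u_0$ into $V_h^0\cap H(\mathrm{div})$; $$a_h^n(\boldsymbol{u},\boldsymbol{v})=\sum_{\mathcal{K}}\int_{\mathcal{K}}\nu\nabla u:\nabla v\,dx\,dt+\sum_{\mathcal{K}}\int_{\mathcal{Q}^n_{\mathcal{K}}}\frac{\nu\alpha}{h_{\mathcal{K}}}(u-\bar u)\cdot(v-\bar v)\,ds-\sum_{\mathcal{K}}\int_{\mathcal{Q}^n_{\mathcal{K}}}\nu\Big[(u-\bar u)\cdot\frac{\partial v}{\partial n}+\frac{\partial u}{\partial n}\cdot(v-\bar v)\Big]ds,$$ with penalty parameter $\alpha>0$ (sufficiently large); $$b_h^n(\boldsymbol{p},\boldsymbol{v})=-\sum_{\mathcal{K}}\int_{\mathcal{K}}p\,\nabla\cdot v\,dx\,dt+\sum_{\mathcal{K}}\int_{\mathcal{Q}^n_{\mathcal{K}}}(v-\bar v)\cdot n\,\bar p\,ds;$$ $$\begin{aligned}t_h^n(\boldsymbol{w};\boldsymbol{u},\boldsymbol{v})=&\sum_{\mathcal{K}}\int_{\mathcal{Q}^n_{\mathcal{K}}}(n_t+w\cdot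 n)(u+\lambda(\bar u-u))\cdot(v-\bar v)\,ds-\sum_{\mathcal{K}}\int_{\mathcal{Q}^n_{\mathcal{K}}}\tfrac12(w\cdot n)(u\cdot v-\bar u\cdot\bar v)\,ds\\&-\sum_{\mathcal{K}}\int_{\mathcal{K}}(u\cdot\partial_tv+u\otimes w:\nabla v)\,dx\,dt+\sum_{\mathcal{K}}\int_{\mathcal{K}}\tfrac12(u\otimes w:\nabla v+v\otimes w:\nabla u)\,dx\,dt\\&+\int_{\partial\mathcal{E}^N\cap\partial\mathcal{E}^n}\max(n_t+\bar w\cdot n,0)\,\bar u\cdot\bar v\,ds-\int_{\partial\mathcal{E}^N\cap\partial\mathcal{E}^n}\tfrac12(\bar w\cdot n)\,\bar u\cdot\bar v\,ds+\sum_{\mathcal{K}}\int_{K^{n+1}}u\cdot v\,dx,\end{aligned}$$ where on $\mathcal{Q}^n_{\mathcal{K}}$ the upwind indicator is $\lambda=1$ if $n_t+w\cdot n<0$ and $\lambda=0$ otherwise. *)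

theory Defs
  imports "HOL-Analysis.Analysis"
begin

text \<open>
  Points of space-time are pairs \<open>(t, x)\<close>; the product inner product is the Euclidean one
  on \<open>\<real>\<^sup>d\<^sup>+\<^sup>1\<close>, \<open>d = CARD('d)\<close>.
\<close>

type_synonym 'd spacetime = "real \<times> (real ^ 'd)"

definition moving_domain :: "real \<Rightarrow> (real \<Rightarrow> (real ^ 'd) set) \<Rightarrow> bool" where
  "moving_domain T \<Omega> \<longleftrightarrow>
     (\<forall>t\<in>{0..T}. open (\<Omega> t) \<and> connected (\<Omega> t) \<and> \<Omega> t \<noteq> {}) \<and>
     \<comment> \<open>continuity in the Hausdorff distance\<close>
     (\<forall>t\<in>{0..T}. \<forall>\<epsilon>>0. \<exists>\<delta>>0. \<forall>s\<in>{0..T}. \<bar>s - t\<bar> < \<delta> \<longrightarrow>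
        \<Omega> s \<subseteq> (\<Union>x\<in>\<Omega> t. ball x \<epsilon>) \<and> \<Omega> t \<subseteq> (\<Union>x\<in>\<Omega> s. ball x \<epsilon>))"

definition spacetime_domain :: "real \<Rightarrow> (real \<Rightarrow> (real ^ 'd) set) \<Rightarrow> 'd spacetime set" where
  "spacetime_domain T \<Omega> = {(t, x). 0 < t \<and> t < T \<and> x \<in> \<Omega> t}"

definition boundary_partition ::
  "real \<Rightarrow> (real \<Rightarrow> (real ^ 'd) set) \<Rightarrow> 'd spacetime set \<Rightarrow> 'd spacetime set \<Rightarrow> bool" where
  "boundary_partition T \<Omega> ED EN \<longleftrightarrow>
     ED \<in> sets borel \<and> EN \<in> sets borel \<and>
     frontier (spacetime_domain T \<Omega>) = ED \<union> EN \<union> {0} \<times> \<Omega> 0 \<union> {T} \<times> \<Omega> T \<and>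
     ED \<inter> EN = {} \<and> (ED \<union> EN) \<inter> ({0} \<times> \<Omega> 0 \<union> {T} \<times> \<Omega> T) = {}"

definition time_partition :: "real \<Rightarrow> nat \<Rightarrow> (nat \<Rightarrow> real) \<Rightarrow> bool" where
  "time_partition T N \<tau> \<longleftrightarrow> \<tau> 0 = 0 \<and> \<tau> N = T \<and> (\<forall>n<N. \<tau> n < \<tau> (Suc n))"

definition slab ::
  "real \<Rightarrow> (real \<Rightarrow> (real ^ 'd) set) \<Rightarrow> (nat \<Rightarrow> real) \<Rightarrow> nat \<Rightarrow> 'd spacetime set" where
  "slab T \<Omega> \<tau> n = {z \<in> spacetime_domain T \<Omega>. \<tau> n < fst z \<and> fst z < \<tau> (Suc n)}"

text \<open>Only the lateral part of the boundary of the slab, without its bottom and top.\<close>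

definition slab_boundary ::
  "real \<Rightarrow> (real \<Rightarrow> (real ^ 'd) set) \<Rightarrow> (nat \<Rightarrow> real) \<Rightarrow> nat \<Rightarrow> 'd spacetime set" where
  "slab_boundary T \<Omega> \<tau> n =
     {z \<in> frontier (spacetime_domain T \<Omega>). \<tau> n < fst z \<and> fst z < \<tau> (Suc n)}"

definition unit_normal :: "'d::finite spacetime set \<Rightarrow> 'd spacetime set \<Rightarrow> 'd spacetime" where
  "unit_normal K S = (THE \<nu>. norm \<nu> = 1 \<and> (\<forall>z\<in>S. \<forall>w\<in>S. \<nu> \<bullet> (w - z) = 0) \<and>
                             (\<forall>z\<in>S. \<forall>w\<in>K. \<nu> \<bullet> (w - z) \<le> 0))"

definition lateral_facets :: "'d::finite spacetime set \<Rightarrow> 'd spacetime set set" where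
  "lateral_facets K = {S. S facet_of K \<and> \<bar>fst (unit_normal K S)\<bar> \<noteq> 1}"

definition top_facets :: "'d::finite spacetime set \<Rightarrow> 'd spacetime set set" where
  "top_facets K = {S. S facet_of K \<and> fst (unit_normal K S) = 1}"

text \<open>The skeleton excludes the horizontal facets, on which the spatial normal vanishes.\<close>

definition mesh_facets :: "'d::finite spacetime set set \<Rightarrow> 'd spacetime set set" where
  "mesh_facets TT = (\<Union>K\<in>TT. lateral_facets K)"

definition boundary_facets ::
  "'d::finite spacetime set \<Rightarrow> 'd spacetime set set \<Rightarrow> 'd spacetime set set" where
  "boundary_facets E TT = {S \<in> mesh_facets TT. S \<subseteq> frontier E}"

definition interior_facets ::
  "'d::finite spacetime set \<Rightarrow> 'd spacetime set set \<Rightarrow> 'd spacetime set set" where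
  "interior_facets E TT = mesh_facets TT - boundary_facets E TT"

text \<open>
  \<open>triangulation\<close> makes the mesh finite and conforming.  Since the slab is required to be the
  interior of the union of its simplices, it lies locally on one side of its boundary (no slits).
\<close>

definition slab_mesh :: "'d::finite spacetime set \<Rightarrow> 'd spacetime set set \<Rightarrow> bool" where
  "slab_mesh E TT \<longleftrightarrow>
     triangulation TT \<and> (\<forall>K\<in>TT. (int CARD('d) + 1) simplex K) \<and>
     \<Union>TT = closure E \<and> interior (\<Union>TT) = E \<and>
     (\<forall>K\<in>TT. \<forall>S S'. S facet_of K \<and> \<bar>fst (unit_normal K S)\<bar> = 1 \<and>
                    S' facet_of K \<and> \<bar>fst (unit_normal K S')\<bar> = 1 \<longrightarrow> S = S')"

definition matching_at ::
  "real \<Rightarrow> 'd::finite spacetime set set \<Rightarrow> 'd spacetime set set \<Rightarrow> bool" where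
  "matching_at t TT TT' \<longleftrightarrow>
     {S. (\<exists>K\<in>TT. S facet_of K) \<and> S \<subseteq> {t} \<times> UNIV} =
     {S. (\<exists>K\<in>TT'. S facet_of K) \<and> S \<subseteq> {t} \<times> UNIV}"

definition spacetime_mesh ::
  "real \<Rightarrow> (real \<Rightarrow> (real ^ 'd::finite) set) \<Rightarrow> nat \<Rightarrow> (nat \<Rightarrow> real) \<Rightarrow>
   (nat \<Rightarrow> 'd spacetime set set) \<Rightarrow> bool" where
  "spacetime_mesh T \<Omega> N \<tau> TT \<longleftrightarrow>
     (\<forall>n<N. slab_mesh (slab T \<Omega> \<tau> n) (TT n)) \<and>
     (\<forall>n. Suc n < N \<longrightarrow> matching_at (\<tau> (Suc n)) (TT n) (TT (Suc n)))"

text \<open>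
  Surface measure on the hyperplane spanned by a facet: image of Lebesgue measure on
  \<open>\<real>\<^sup>d\<close> under an isometric parametrisation (and independent of its choice).
\<close>

definition flat_chart :: "'d::finite spacetime set \<Rightarrow> real ^ 'd \<Rightarrow> 'd spacetime" where
  "flat_chart S = (SOME \<Phi>. (\<forall>x y. dist (\<Phi> x) (\<Phi> y) = dist x y) \<and> range \<Phi> = affine hull S)"

definition surface_measure :: "'d::finite spacetime set \<Rightarrow> 'd spacetime measure" where
  "surface_measure S = completion (distr lborel borel (flat_chart S))"

text \<open>
  The integral over the part in \<open>A\<close> of the boundary of \<open>K\<close> without its horizontal facets;
  the integrand also receives the outward unit normal.
\<close>

definition lateral_integral ::
  "'d::finite spacetime set \<Rightarrow> 'd spacetime set \<Rightarrow>
   ('d spacetime \<Rightarrow> 'd spacetime \<Rightarrow> real) \<Rightarrow> real" where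
  "lateral_integral A K \<phi> =
     (\<Sum>S\<in>lateral_facets K. LINT z:S \<inter> A|surface_measure S. \<phi> (unit_normal K S) z)"

text \<open>Trace on the closed simplex \<open>K\<close> of a function given in its interior.\<close>

definition tr :: "'d::finite spacetime set \<Rightarrow> ('d spacetime \<Rightarrow> 'b::t2_space) \<Rightarrow> 'd spacetime \<Rightarrow> 'b"
  where "tr K v z = Lim (at z within interior K) v"

definition dt :: "('d::finite spacetime \<Rightarrow> real ^ 'd) \<Rightarrow> 'd spacetime \<Rightarrow> real ^ 'd" where
  "dt v z = frechet_derivative v (at z) (1, 0)"

definition grad :: "('d::finite spacetime \<Rightarrow> real ^ 'd) \<Rightarrow> 'd spacetime \<Rightarrow> real ^ 'd ^ 'd" where
  "grad v z = (\<chi> i j. frechet_derivative v (at z) (0, axis j 1) $ i)"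

definition divg :: "('d::finite spacetime \<Rightarrow> real ^ 'd) \<Rightarrow> 'd spacetime \<Rightarrow> real" where
  "divg v z = trace (grad v z)"

text \<open>The inner product \<open>A \<bullet> B\<close> of two matrices is the Frobenius product.\<close>

definition outer_prod :: "real ^ 'd \<Rightarrow> real ^ 'd \<Rightarrow> real ^ 'd ^ 'd" where
  "outer_prod u w = (\<chi> i j. u $ i * w $ j)"

text \<open>Polynomials of total degree at most \<open>l\<close>; \<open>m\<close> ranges over the multi-indices.\<close>

definition polys :: "nat \<Rightarrow> ('a::euclidean_space \<Rightarrow> real) set" where
  "polys l = {p. \<exists>c. \<forall>z. p z =
     (\<Sum>m \<in> {m \<in> Basis \<rightarrow>\<^sub>E {..l}. (\<Sum>b\<in>Basis. m b) \<le> l}. c m * (\<Prod>b\<in>Basis. (z \<bullet> b) ^ m b))}"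

text \<open>
  A class in a broken space is represented by functions that are polynomial on the interior of
  every simplex (on the relative interior of every facet, respectively); the values on the
  remaining null set are irrelevant.  Being in \<open>L\<^sup>2\<close> is then automatic.
\<close>

definition Vh :: "nat \<Rightarrow> 'd::finite spacetime set set \<Rightarrow> ('d spacetime \<Rightarrow> real ^ 'd) set" where
  "Vh k TT = {v. \<forall>K\<in>TT. \<forall>i. \<exists>p\<in>polys k. \<forall>z\<in>interior K. v z $ i = p z}"

definition Qh :: "nat \<Rightarrow> 'd::finite spacetime set set \<Rightarrow> ('d spacetime \<Rightarrow> real) set" where
  "Qh k TT = {q. \<forall>K\<in>TT. \<exists>p\<in>polys (k - 1). \<forall>z\<in>interior K. q z = p z}"

text \<open>\<open>bD\<close> is the Dirichlet part of the lateral boundary of the slab.\<close>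

definition Vbarh ::
  "nat \<Rightarrow> 'd::finite spacetime set \<Rightarrow> 'd spacetime set set \<Rightarrow> ('d spacetime \<Rightarrow> real ^ 'd) set" where
  "Vbarh k bD TT = {vb. \<forall>S\<in>mesh_facets TT.
     (\<forall>i. \<exists>p\<in>polys k. \<forall>z\<in>rel_interior S. vb z $ i = p z) \<and>
     (AE z in surface_measure S. z \<in> S \<inter> bD \<longrightarrow> vb z = 0)}"

definition Qbarh :: "nat \<Rightarrow> 'd::finite spacetime set set \<Rightarrow> ('d spacetime \<Rightarrow> real) set" where
  "Qbarh k TT = {qb. \<forall>S\<in>mesh_facets TT. \<exists>p\<in>polys k. \<forall>z\<in>rel_interior S. qb z = p z}"

datatype variant = HDG | EHDG

definition Xv :: "variant \<Rightarrow> nat \<Rightarrow> 'd::finite spacetime set \<Rightarrow> 'd spacetime set set \<Rightarrow>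
  (('d spacetime \<Rightarrow> real ^ 'd) \<times> ('d spacetime \<Rightarrow> real ^ 'd)) set" where
  "Xv s k bD TT =
     (case s of
        HDG \<Rightarrow> Vh k TT \<times> Vbarh k bD TT
      | EHDG \<Rightarrow> Vh k TT \<times> {vb \<in> Vbarh k bD TT. continuous_on (\<Union>(mesh_facets TT)) vb})"

definition Xq :: "nat \<Rightarrow> 'd::finite spacetime set set \<Rightarrow>
  (('d spacetime \<Rightarrow> real) \<times> ('d spacetime \<Rightarrow> real)) set" where
  "Xq k TT = Qh k TT \<times> Qbarh k TT"

definition ah :: "real \<Rightarrow> real \<Rightarrow> ('d::finite spacetime set \<Rightarrow> real) \<Rightarrow> 'd spacetime set set \<Rightarrow>
   ('d spacetime \<Rightarrow> real ^ 'd) \<times> ('d spacetime \<Rightarrow> real ^ 'd) \<Rightarrow>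
   ('d spacetime \<Rightarrow> real ^ 'd) \<times> ('d spacetime \<Rightarrow> real ^ 'd) \<Rightarrow> real" where
  "ah \<nu> \<alpha> h TT U V = (case U of (u, ub) \<Rightarrow> case V of (v, vb) \<Rightarrow>
     (\<Sum>K\<in>TT. LINT z:K|lebesgue. \<nu> * (grad u z \<bullet> grad v z))
   + (\<Sum>K\<in>TT. lateral_integral UNIV K (\<lambda>\<eta> z.
        \<nu> * \<alpha> / h K * ((tr K u z - ub z) \<bullet> (tr K v z - vb z))))
   - (\<Sum>K\<in>TT. lateral_integral UNIV K (\<lambda>\<eta> z.
        \<nu> * ((tr K u z - ub z) \<bullet> (tr K (grad v) z *v snd \<eta>)
           + (tr K (grad u) z *v snd \<eta>) \<bullet> (tr K v z - vb z)))))"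

definition bh :: "'d::finite spacetime set set \<Rightarrow>
   ('d spacetime \<Rightarrow> real) \<times> ('d spacetime \<Rightarrow> real) \<Rightarrow>
   ('d spacetime \<Rightarrow> real ^ 'd) \<times> ('d spacetime \<Rightarrow> real ^ 'd) \<Rightarrow> real" where
  "bh TT P V = (case P of (p, pb) \<Rightarrow> case V of (v, vb) \<Rightarrow>
   - (\<Sum>K\<in>TT. LINT z:K|lebesgue. p z * divg v z)
   + (\<Sum>K\<in>TT. lateral_integral UNIV K (\<lambda>\<eta> z. ((tr K v z - vb z) \<bullet> snd \<eta>) * pb z)))"

text \<open>
  \<open>bN\<close> is the Neumann part of the lateral boundary of the slab.  The integrals over it are
  written as sums over all simplices and facets: the interior facets meet it in null sets only.
\<close>

definition th :: "'d::finite spacetime set \<Rightarrow> 'd spacetime set set \<Rightarrow>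
   ('d spacetime \<Rightarrow> real ^ 'd) \<times> ('d spacetime \<Rightarrow> real ^ 'd) \<Rightarrow>
   ('d spacetime \<Rightarrow> real ^ 'd) \<times> ('d spacetime \<Rightarrow> real ^ 'd) \<Rightarrow>
   ('d spacetime \<Rightarrow> real ^ 'd) \<times> ('d spacetime \<Rightarrow> real ^ 'd) \<Rightarrow> real" where
  "th bN TT W U V = (case W of (w, wb) \<Rightarrow> case U of (u, ub) \<Rightarrow> case V of (v, vb) \<Rightarrow>
     (\<Sum>K\<in>TT. lateral_integral UNIV K (\<lambda>\<eta> z.
        let s = fst \<eta> + tr K w z \<bullet> snd \<eta>; lam = (if s < 0 then 1 else 0)
        in s * ((tr K u z + lam *\<^sub>R (ub z - tr K u z)) \<bullet> (tr K v z - vb z))))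
   - (\<Sum>K\<in>TT. lateral_integral UNIV K (\<lambda>\<eta> z.
        1/2 * (tr K w z \<bullet> snd \<eta>) * (tr K u z \<bullet> tr K v z - ub z \<bullet> vb z)))
   - (\<Sum>K\<in>TT. LINT z:K|lebesgue. u z \<bullet> dt v z + outer_prod (u z) (w z) \<bullet> grad v z)
   + (\<Sum>K\<in>TT. LINT z:K|lebesgue.
        1/2 * (outer_prod (u z) (w z) \<bullet> grad v z + outer_prod (v z) (w z) \<bullet> grad u z))
   + (\<Sum>K\<in>TT. lateral_integral bN K (\<lambda>\<eta> z.
        max (fst \<eta> + wb z \<bullet> snd \<eta>) 0 * (ub z \<bullet> vb z)))
   - (\<Sum>K\<in>TT. lateral_integral bN K (\<lambda>\<eta> z. 1/2 * (wb z \<bullet> snd \<eta>) * (ub z \<bullet> vb z)))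
   + (\<Sum>K\<in>TT. \<Sum>S\<in>top_facets K. LINT z:S|surface_measure S. tr K u z \<bullet> tr K v z))"

text \<open>\<open>um\<close> is the velocity entering the slab through its bottom \<open>O\<close> at time \<open>t\<close>.\<close>

definition Lh :: "('d::finite spacetime \<Rightarrow> real ^ 'd) \<Rightarrow> ('d spacetime \<Rightarrow> real ^ 'd) \<Rightarrow>
   'd spacetime set \<Rightarrow> 'd spacetime set set \<Rightarrow> (real ^ 'd) set \<Rightarrow> real \<Rightarrow> (real ^ 'd \<Rightarrow> real ^ 'd) \<Rightarrow>
   ('d spacetime \<Rightarrow> real ^ 'd) \<times> ('d spacetime \<Rightarrow> real ^ 'd) \<Rightarrow> real" where
  "Lh f g bN TT \<O> t um V = (case V of (v, vb) \<Rightarrow>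
     (\<Sum>K\<in>TT. LINT z:K|lebesgue. f z \<bullet> v z)
   - (\<Sum>K\<in>TT. lateral_integral bN K (\<lambda>\<eta> z. g z \<bullet> vb z))
   + (LINT x:\<O>|lebesgue. um x \<bullet> Lim (at_right 0) (\<lambda>\<epsilon>. v (t + \<epsilon>, x))))"

definition test_function :: "(real ^ 'd) set \<Rightarrow> (real ^ 'd::finite \<Rightarrow> real) \<Rightarrow> bool" where
  "test_function \<O> \<phi> \<longleftrightarrow>
     (\<forall>x. \<phi> differentiable (at x)) \<and>
     (\<forall>j. continuous_on UNIV (\<lambda>x. frechet_derivative \<phi> (at x) (axis j 1))) \<and>
     compact (closure {x. \<phi> x \<noteq> 0}) \<and> closure {x. \<phi> x \<noteq> 0} \<subseteq> \<O>"

text \<open>Square integrable with vanishing weak divergence, hence in \<open>H(div)\<close>.\<close>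

definition div_free :: "(real ^ 'd) set \<Rightarrow> (real ^ 'd::finite \<Rightarrow> real ^ 'd) \<Rightarrow> bool" where
  "div_free \<O> v \<longleftrightarrow>
     v \<in> borel_measurable (lebesgue_on \<O>) \<and> integrable (lebesgue_on \<O>) (\<lambda>x. (norm (v x))\<^sup>2) \<and>
     (\<forall>\<phi>. test_function \<O> \<phi> \<longrightarrow>
        (LINT x:\<O>|lebesgue. (\<Sum>j\<in>UNIV. v x $ j * frechet_derivative \<phi> (at x) (axis j 1))) = 0)"

text \<open>
  Exactly divergence-free fields on \<open>\<Omega>(0)\<close> that are polynomial of degree at most \<open>k\<close> on each
  facet of the mesh \<open>TT\<close> of the first slab at time 0.
\<close>

definition W0 :: "nat \<Rightarrow> 'd::finite spacetime set set \<Rightarrow> (real ^ 'd) set \<Rightarrow>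
   (real ^ 'd \<Rightarrow> real ^ 'd) set" where
  "W0 k TT \<O> = {w. div_free \<O> w \<and>
     (\<forall>K\<in>TT. \<forall>S. S facet_of K \<and> S \<subseteq> {0} \<times> UNIV \<longrightarrow>
        (\<forall>i. \<exists>p\<in>polys k. \<forall>x. (0, x) \<in> rel_interior S \<longrightarrow> w x $ i = p x))}"

text \<open>
  An arbitrary linear projection onto \<open>W0\<close>, defined on a linear space \<open>X\<close> of vector fields
  (interpolation operators need not be defined for all square integrable fields).
\<close>

definition div_free_projection ::
  "nat \<Rightarrow> 'd::finite spacetime set set \<Rightarrow> (real ^ 'd) set \<Rightarrow> (real ^ 'd \<Rightarrow> real ^ 'd) set \<Rightarrow>
   ((real ^ 'd \<Rightarrow> real ^ 'd) \<Rightarrow> (real ^ 'd \<Rightarrow> real ^ 'd)) \<Rightarrow> bool" where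
  "div_free_projection k TT \<O> X P \<longleftrightarrow>
     W0 k TT \<O> \<subseteq> X \<and> (\<forall>v\<in>X. P v \<in> W0 k TT \<O>) \<and>
     (\<forall>w\<in>W0 k TT \<O>. AE x in lebesgue_on \<O>. P w x = w x) \<and>
     (\<forall>v\<in>X. \<forall>w\<in>X. \<forall>a b. (\<lambda>x. a *\<^sub>R v x + b *\<^sub>R w x) \<in> X \<and>
        (AE x in lebesgue_on \<O>. P (\<lambda>x. a *\<^sub>R v x + b *\<^sub>R w x) x = a *\<^sub>R P v x + b *\<^sub>R P w x))"

fun u_minus :: "(nat \<Rightarrow> real) \<Rightarrow> (real ^ 'd::finite \<Rightarrow> real ^ 'd) \<Rightarrow>
   (nat \<Rightarrow> 'd spacetime \<Rightarrow> real ^ 'd) \<Rightarrow> nat \<Rightarrow> real ^ 'd \<Rightarrow> real ^ 'd" where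
  "u_minus \<tau> u0h u 0 = u0h"
| "u_minus \<tau> u0h u (Suc n) = (\<lambda>x. Lim (at_right 0) (\<lambda>\<epsilon>. u n (\<tau> (Suc n) - \<epsilon>, x)))"

definition slab_solution ::
  "variant \<Rightarrow> nat \<Rightarrow> real \<Rightarrow> real \<Rightarrow> ('d::finite spacetime set \<Rightarrow> real) \<Rightarrow>
   ('d spacetime \<Rightarrow> real ^ 'd) \<Rightarrow> ('d spacetime \<Rightarrow> real ^ 'd) \<Rightarrow>
   'd spacetime set \<Rightarrow> 'd spacetime set \<Rightarrow> 'd spacetime set set \<Rightarrow>
   (real ^ 'd) set \<Rightarrow> real \<Rightarrow> (real ^ 'd \<Rightarrow> real ^ 'd) \<Rightarrow>
   ('d spacetime \<Rightarrow> real ^ 'd) \<times> ('d spacetime \<Rightarrow> real ^ 'd) \<Rightarrow>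
   ('d spacetime \<Rightarrow> real) \<times> ('d spacetime \<Rightarrow> real) \<Rightarrow> bool" where
  "slab_solution s k \<nu> \<alpha> h f g bD bN TT \<O> t um U P \<longleftrightarrow>
     U \<in> Xv s k bD TT \<and> P \<in> Xq k TT \<and>
     (\<forall>V\<in>Xv s k bD TT. th bN TT U U V + ah \<nu> \<alpha> h TT U V + bh TT P V = Lh f g bN TT \<O> t um V) \<and>
     (\<forall>Q\<in>Xq k TT. bh TT Q U = 0)"

end

theory Submission
  imports Defs
begin

text \<open>
  Mass conservation comes from the discrete continuity equation \<open>b\<^sub>h(q, u) = 0\<close>, tested with
  pressures \<open>q\<close> that live on a single simplex or on a single facet.

  \<^item> The divergence of the velocity is a polynomial of degree at most \<open>k - 1\<close> on each simplex
    \<open>K\<close>, so its restriction to \<open>K\<close>, extended by zero, is an admissible element pressure.  The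
    equation then says that the square of the divergence has integral zero over \<open>K\<close>.

  \<^item> The sum \<open>G\<close> over the simplices \<open>K\<close> adjacent to a facet \<open>S\<close> of the polynomials
    \<open>(u - ub) \<bullet> n\<^sub>K\<close> has degree at most \<open>k\<close>, so \<open>G\<close> on \<open>S\<close>, extended by zero, is an admissible
    facet pressure.  The equation then says that the square of \<open>G\<close> has integral zero over \<open>S\<close>;
    this is \<open>facet_flux_balance\<close>.

  In both cases a continuous function whose square integrates to zero over a set that is open (in
  space-time, or in the hyperplane of the facet) vanishes on that set.  It remains to read off
  which simplices contribute to \<open>G\<close>, and this is where the geometry of the mesh enters.  A
  simplex contains a one-sided neighbourhood of each relative interior point of its facets
  (\<open>one_sided_neighbourhood\<close>).  Two simplices on the same side of a common facet would
  therefore overlap; so a facet has at most two adjacent simplices, and if there are two, then their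
  normals are opposite, the facet velocity cancels in \<open>G\<close>, and \<open>G\<close> is the normal jump.  Two simplices on opposite
  sides cover a full neighbourhood; so a facet on the boundary of the slab belongs to just one
  simplex, and \<open>G\<close> is the normal component of \<open>u - ub\<close>.

  The choice between the two methods affects the facet velocities but not the pressures, so the
  argument is the same for both.
\<close>

section \<open>Polynomials\<close>

abbreviation multi_indices :: "nat \<Rightarrow> ('a::euclidean_space \<Rightarrow> nat) set" where
  "multi_indices l \<equiv> {m \<in> Basis \<rightarrow>\<^sub>E {..l}. (\<Sum>b\<in>Basis. m b) \<le> l}"

lemma finite_multi_indices: "finite (multi_indices l :: ('a::euclidean_space \<Rightarrow> nat) set)"
proof (rule finite_subset)
  show "multi_indices l \<subseteq> (Basis :: 'a set) \<rightarrow>\<^sub>E {..l}" by auto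
qed (simp add: finite_PiE)

lemma monomial_in_polys:
  assumes "m \<in> multi_indices l"
  shows "(\<lambda>z::'a::euclidean_space. \<Prod>b\<in>Basis. (z \<bullet> b) ^ m b) \<in> polys l"
  unfolding polys_def
proof (intro CollectI exI allI)
  fix z :: 'a
  show "(\<Prod>b\<in>Basis. (z \<bullet> b) ^ m b) =
    (\<Sum>m'\<in>multi_indices l. (if m' = m then 1 else 0) * (\<Prod>b\<in>Basis. (z \<bullet> b) ^ m' b))"
    using assms by (simp add: if_distrib [of "\<lambda>c. c * _"] finite_multi_indices cong: if_cong)
qed

lemma polys_zero: "(\<lambda>z. 0) \<in> polys l"
  unfolding polys_def by (intro CollectI exI [of _ "\<lambda>_. 0"]) simp

lemma polys_add:
  assumes "p \<in> polys l" "q \<in> polys l"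
  shows "(\<lambda>z. p z + q z) \<in> polys l"
proof -
  from assms obtain c d where
    "\<And>z. p z = (\<Sum>m\<in>multi_indices l. c m * (\<Prod>b\<in>Basis. (z \<bullet> b) ^ m b))"
    "\<And>z. q z = (\<Sum>m\<in>multi_indices l. d m * (\<Prod>b\<in>Basis. (z \<bullet> b) ^ m b))"
    unfolding polys_def by blast
  then show ?thesis
    unfolding polys_def
    by (intro CollectI exI [of _ "\<lambda>m. c m + d m"]) (simp add: distrib_right sum.distrib)
qed

lemma polys_scale:
  assumes "p \<in> polys l"
  shows "(\<lambda>z. a * p z) \<in> polys l"
proof -
  from assms obtain c where
    "\<And>z. p z = (\<Sum>m\<in>multi_indices l. c m * (\<Prod>b\<in>Basis. (z \<bullet> b) ^ m b))"
    unfolding polys_def by blast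
  then show ?thesis
    unfolding polys_def
    by (intro CollectI exI [of _ "\<lambda>m. a * c m"]) (simp add: sum_distrib_left mult.assoc)
qed

lemma polys_sum:
  assumes "\<And>i. i \<in> I \<Longrightarrow> p i \<in> polys l"
  shows "(\<lambda>z. \<Sum>i\<in>I. p i z) \<in> polys l"
  using assms
  by (induction I rule: infinite_finite_induct) (simp_all add: polys_zero polys_add)

lemma polys_continuous_on:
  assumes "p \<in> polys l"
  shows "continuous_on A p"
proof -
  from assms obtain c where
    p: "\<And>z. p z = (\<Sum>m\<in>multi_indices l. c m * (\<Prod>b\<in>Basis. (z \<bullet> b) ^ m b))"
    unfolding polys_def by blast
  show ?thesis
    unfolding p by (intro continuous_intros)
qed

lemma monomial_derivative_Basis:
  fixes b0 z :: "'a::euclidean_space"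
  assumes "b0 \<in> Basis"
  shows "\<exists>D. ((\<lambda>z. \<Prod>b\<in>Basis. (z \<bullet> b) ^ m b) has_derivative D) (at z) \<and>
    D b0 = real (m b0) * (\<Prod>b\<in>Basis. (z \<bullet> b) ^ (m(b0 := m b0 - 1)) b)"
proof (intro exI conjI)
  let ?D = "\<lambda>y. \<Sum>i\<in>Basis. (real (m i) * (y \<bullet> i) * (z \<bullet> i) ^ (m i - 1)) *
      (\<Prod>j\<in>Basis - {i}. (z \<bullet> j) ^ m j)"
  show "((\<lambda>z. \<Prod>b\<in>Basis. (z \<bullet> b) ^ m b) has_derivative ?D) (at z)"
  proof (rule has_derivative_prod)
    fix i :: 'a
    show "((\<lambda>z. (z \<bullet> i) ^ m i) has_derivative
        (\<lambda>y. real (m i) * (y \<bullet> i) * (z \<bullet> i) ^ (m i - 1))) (at z)"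
      by (auto intro!: derivative_eq_intros)
  qed
  have "?D b0 = (\<Sum>i\<in>Basis. if i = b0 then real (m b0) * ((z \<bullet> b0) ^ (m b0 - 1) *
      (\<Prod>j\<in>Basis - {b0}. (z \<bullet> j) ^ m j)) else 0)"
    using assms by (intro sum.cong) (auto simp: inner_Basis)
  also have "\<dots> = real (m b0) * ((z \<bullet> b0) ^ (m b0 - 1) * (\<Prod>j\<in>Basis - {b0}. (z \<bullet> j) ^ m j))"
    using assms by simp
  also have "(z \<bullet> b0) ^ (m b0 - 1) * (\<Prod>j\<in>Basis - {b0}. (z \<bullet> j) ^ m j) =
      (\<Prod>b\<in>Basis. (z \<bullet> b) ^ (m(b0 := m b0 - 1)) b)"
    using assms by (subst prod.remove [of _ b0]) auto
  finally show "?D b0 = real (m b0) * (\<Prod>b\<in>Basis. (z \<bullet> b) ^ (m(b0 := m b0 - 1)) b)" .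
qed

lemma scaled_lowered_monomial_in_polys:
  assumes m: "m \<in> multi_indices l" and b0: "b0 \<in> Basis"
  shows "(\<lambda>z::'a::euclidean_space. real (m b0) *
    (\<Prod>b\<in>Basis. (z \<bullet> b) ^ (m(b0 := m b0 - 1)) b)) \<in> polys (l - 1)"
proof (cases "m b0 = 0")
  case True
  then show ?thesis by (simp add: polys_zero)
next
  case False
  let ?m = "m(b0 := m b0 - 1)"
  have "sum m Basis = m b0 + sum m (Basis - {b0})"
    using b0 by (simp add: sum.remove)
  moreover have "sum ?m Basis = ?m b0 + sum ?m (Basis - {b0})"
    using b0 by (intro sum.remove) auto
  moreover have "sum ?m (Basis - {b0}) = sum m (Basis - {b0})"
    by (intro sum.cong) auto
  moreover have "sum m Basis \<le> l" using m by simp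
  ultimately have s: "sum ?m Basis \<le> l - 1"
    using False by (simp only: fun_upd_same)
  have "?m b \<le> l - 1" if "b \<in> Basis" for b
    using member_le_sum [of b Basis ?m] s that by (meson finite_Basis le_trans zero_le)
  moreover have "?m \<in> extensional Basis"
    using m b0 by (auto simp: PiE_def extensional_def)
  ultimately have "?m \<in> multi_indices (l - 1)"
    using s by (auto simp: PiE_def)
  then show ?thesis
    by (intro polys_scale monomial_in_polys)
qed

text \<open>
  Differentiation along a coordinate sends a monomial to a multiple of the monomial with one
  exponent lowered.  The multiple is zero when that exponent is zero, which is why truncated
  subtraction in \<open>l - 1\<close> gives the right statement also for \<open>l = 0\<close>.
\<close>

lemma polys_derivative:
  fixes p :: "'a::euclidean_space \<Rightarrow> real"
  assumes "p \<in> polys l" and "b0 \<in> Basis"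
  shows "p differentiable (at z)" "(\<lambda>z. frechet_derivative p (at z) b0) \<in> polys (l - 1)"
proof -
  from assms obtain c where
    p: "p = (\<lambda>z. \<Sum>m\<in>multi_indices l. c m * (\<Prod>b\<in>Basis. (z \<bullet> b) ^ m b))"
    unfolding polys_def by blast
  have "\<exists>D. \<forall>m z. ((\<lambda>z. \<Prod>b\<in>Basis. (z \<bullet> b) ^ m b) has_derivative D m z) (at z) \<and>
    D m z b0 = real (m b0) * (\<Prod>b\<in>Basis. (z \<bullet> b) ^ (m(b0 := m b0 - 1)) b)"
    using monomial_derivative_Basis [OF \<open>b0 \<in> Basis\<close>] by metis
  then obtain D where
    D: "\<And>m z. ((\<lambda>z. \<Prod>b\<in>Basis. (z \<bullet> b) ^ m b) has_derivative D m z) (at z)"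
      "\<And>m z. D m z b0 = real (m b0) * (\<Prod>b\<in>Basis. (z \<bullet> b) ^ (m(b0 := m b0 - 1)) b)"
    by blast
  have p': "(p has_derivative (\<lambda>y. \<Sum>m\<in>multi_indices l. c m * D m z y)) (at z)" for z
    unfolding p by (intro has_derivative_sum has_derivative_mult_right D)
  then show "p differentiable (at z)"
    by (auto simp: differentiable_def)
  have "frechet_derivative p (at z) b0 = (\<Sum>m\<in>multi_indices l. c m * D m z b0)" for z
    using fun_cong [OF frechet_derivative_at [OF p' [of z]], of b0] by simp
  then have eq: "(\<lambda>z. frechet_derivative p (at z) b0) =
    (\<lambda>z. \<Sum>m\<in>multi_indices l. c m * (real (m b0) *
      (\<Prod>b\<in>Basis. (z \<bullet> b) ^ (m(b0 := m b0 - 1)) b)))"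
    unfolding D by blast
  show "(\<lambda>z. frechet_derivative p (at z) b0) \<in> polys (l - 1)"
    unfolding eq
    by (intro polys_sum polys_scale scaled_lowered_monomial_in_polys \<open>b0 \<in> Basis\<close>)
qed

text \<open>
  Vanishing almost everywhere becomes vanishing everywhere because the set where a continuous
  function is nonzero is open, and a nonempty open set is not negligible.  Boundedness of \<open>U\<close>
  is what makes the square integrable; the integral of a function that is not integrable is
  zero by convention, and says nothing.
\<close>

lemma continuous_zero_of_integral_square:
  fixes g :: "'a::euclidean_space \<Rightarrow> real"
  assumes "open U" "bounded U" "continuous_on UNIV g"
    and zero: "(LINT x|lborel. indicator U x * (g x)\<^sup>2) = 0"
    and "x \<in> U"
  shows "g x = 0"
proof (rule ccontr)
  assume "g x \<noteq> 0"
  have g: "continuous_on A g" for A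
    using assms(3) continuous_on_subset by blast
  have "integrable lborel (\<lambda>x. indicator (closure U) x *\<^sub>R (g x)\<^sup>2)"
    by (intro borel_integrable_compact continuous_intros g) (use \<open>bounded U\<close> in auto)
  then have int: "integrable lborel (\<lambda>x. indicator U x * (g x)\<^sup>2)"
  proof (rule Bochner_Integration.integrable_bound)
    show "(\<lambda>x. indicator U x * (g x)\<^sup>2) \<in> borel_measurable lborel"
      using borel_measurable_continuous_onI [OF assms(3)] \<open>open U\<close> by simp
  qed (use closure_subset in \<open>auto simp: indicator_def\<close>)
  have "AE x in lborel. indicator U x * (g x)\<^sup>2 = 0"
    using zero integral_nonneg_eq_0_iff_AE [OF int] by simp
  then have "AE x in lebesgue. x \<notin> {x \<in> U. g x \<noteq> 0}"
    by (intro AE_completion) (auto simp: indicator_def)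
  moreover have op: "open {x \<in> U. g x \<noteq> 0}"
  proof -
    have "{x \<in> U. g x \<noteq> 0} = U \<inter> g -` (- {0})" by auto
    then show ?thesis
      using continuous_open_preimage [OF g \<open>open U\<close>, of "- {0}"] by (simp add: open_Compl)
  qed
  ultimately have "negligible {x \<in> U. g x \<noteq> 0}"
    by (subst negligible_iff_null_sets) (auto simp: AE_iff_null_sets borel_open)
  moreover have "{x \<in> U. g x \<noteq> 0} \<noteq> {}" using \<open>x \<in> U\<close> \<open>g x \<noteq> 0\<close> by auto
  ultimately show False using op open_not_negligible by blast
qed

section \<open>Normals to the facets of a convex set\<close>

definition normal_to :: "'a::euclidean_space \<Rightarrow> 'a set \<Rightarrow> bool" where
  "normal_to \<nu> S \<longleftrightarrow> norm \<nu> = 1 \<and> (\<forall>z\<in>S. \<forall>w\<in>S. \<nu> \<bullet> (w - z) = 0)"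

definition outward_normal :: "'a::euclidean_space \<Rightarrow> 'a set \<Rightarrow> 'a set \<Rightarrow> bool" where
  "outward_normal \<nu> K S \<longleftrightarrow> normal_to \<nu> S \<and> (\<forall>z\<in>S. \<forall>w\<in>K. \<nu> \<bullet> (w - z) \<le> 0)"

lemma outward_normal_norm:
  assumes "outward_normal \<nu> K S"
  shows "norm \<nu> = 1"
  using assms unfolding outward_normal_def normal_to_def by (elim conjE)

lemma affine_hull_eq_normal_hyperplane:
  fixes S :: "'a::euclidean_space set"
  assumes "normal_to \<nu> S" "aff_dim S = DIM('a) - 1" "z \<in> S"
  shows "affine hull S = {w. \<nu> \<bullet> w = \<nu> \<bullet> z}"
proof -
  have "\<nu> \<noteq> 0" using assms(1) by (auto simp: normal_to_def)
  moreover have "S \<subseteq> {w. \<nu> \<bullet> w = \<nu> \<bullet> z}"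
  proof
    fix w assume "w \<in> S"
    then have "\<nu> \<bullet> (w - z) = 0" using assms(1,3) unfolding normal_to_def by blast
    then show "w \<in> {w. \<nu> \<bullet> w = \<nu> \<bullet> z}" by (simp add: inner_diff_right)
  qed
  ultimately have "affine hull S = affine hull {w. \<nu> \<bullet> w = \<nu> \<bullet> z}"
    using assms(2) by (subst aff_dim_eq_full_gen [symmetric]) auto
  then show ?thesis
    by (metis affine_hull_eq affine_hyperplane)
qed

text \<open>
  The affine hull of \<open>S\<close> is a hyperplane, which both vectors must annihilate; hence the component
  \<open>v\<close> of \<open>\<mu>\<close> orthogonal to \<open>\<nu>\<close>, being parallel to that hyperplane, is orthogonal to itself.
\<close>

lemma normal_unique_up_to_sign:
  fixes S :: "'a::euclidean_space set"
  assumes \<nu>: "normal_to \<nu> S" and \<mu>: "normal_to \<mu> S"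
    and S: "aff_dim S = DIM('a) - 1" "S \<noteq> {}"
  shows "\<mu> = \<nu> \<or> \<mu> = - \<nu>"
proof -
  obtain z where "z \<in> S" using S by blast
  define c where "c = \<mu> \<bullet> \<nu>"
  define v where "v = \<mu> - c *\<^sub>R \<nu>"
  have "\<nu> \<bullet> \<nu> = 1" using \<nu> by (simp add: normal_to_def dot_square_norm)
  then have v: "\<nu> \<bullet> v = 0"
    by (simp add: v_def c_def inner_diff_right inner_commute)
  then have "z + v \<in> {w. \<nu> \<bullet> w = \<nu> \<bullet> z}" by (simp add: inner_add_right)
  then have "z + v \<in> {w. \<mu> \<bullet> w = \<mu> \<bullet> z}"
    using affine_hull_eq_normal_hyperplane [OF \<nu> S(1) \<open>z \<in> S\<close>]
      affine_hull_eq_normal_hyperplane [OF \<mu> S(1) \<open>z \<in> S\<close>] by simp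
  then have "\<mu> \<bullet> v = 0" by (simp add: inner_add_right)
  then have "v \<bullet> v = 0"
    using v by (simp add: v_def inner_diff_left)
  then have eq: "\<mu> = c *\<^sub>R \<nu>" by (simp add: v_def)
  then have "\<bar>c\<bar> = 1" using \<nu> \<mu> by (auto simp: normal_to_def)
  then consider "c = 1" | "c = - 1" by linarith
  then show ?thesis by cases (simp_all add: eq)
qed

lemma outward_normal_interior:
  assumes "outward_normal \<nu> K S" "z \<in> S" "y \<in> interior K"
  shows "\<nu> \<bullet> (y - z) < 0"
proof -
  have "\<nu> \<noteq> 0" using outward_normal_norm [OF assms(1)] by auto
  have "K \<subseteq> {w. \<nu> \<bullet> w \<le> \<nu> \<bullet> z}"
    using assms(1,2) by (auto simp: outward_normal_def inner_diff_right)
  then have "interior K \<subseteq> {w. \<nu> \<bullet> w < \<nu> \<bullet> z}"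
    using interior_mono interior_halfspace_le [OF \<open>\<nu> \<noteq> 0\<close>] by metis
  then show ?thesis using assms(3) by (auto simp: inner_diff_right)
qed

lemma outward_normal_exists:
  fixes K :: "'a::euclidean_space set"
  assumes "polyhedron K" "S facet_of K"
  shows "\<exists>\<nu>. outward_normal \<nu> K S"
proof -
  have "S exposed_face_of K"
    using assms exposed_face_of_polyhedron by (auto simp: facet_of_def)
  then obtain a b where ab: "K \<subseteq> {x. a \<bullet> x \<le> b}" "S = K \<inter> {x. a \<bullet> x = b}"
    unfolding exposed_face_of_def by blast
  have "S \<noteq> K" "S \<noteq> {}" using assms(2) by (auto simp: facet_of_def)
  then have "a \<noteq> 0" using ab by auto
  have le: "a \<bullet> (w - z) \<le> 0" if "z \<in> S" "w \<in> K" for z w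
    using ab that by (auto simp: inner_diff_right)
  have eq: "a \<bullet> (w - z) = 0" if "z \<in> S" "w \<in> S" for z w
    using ab that by (auto simp: inner_diff_right)
  have "outward_normal (a /\<^sub>R norm a) K S"
    unfolding outward_normal_def normal_to_def
  proof (intro conjI ballI)
    show "norm (a /\<^sub>R norm a) = 1" using \<open>a \<noteq> 0\<close> by simp
    show "(a /\<^sub>R norm a) \<bullet> (w - z) = 0" if "z \<in> S" "w \<in> S" for z w
      using eq [OF that] by simp
    show "(a /\<^sub>R norm a) \<bullet> (w - z) \<le> 0" if "z \<in> S" "w \<in> K" for z w
      using le [OF that] by (simp add: mult_nonneg_nonpos)
  qed
  then show ?thesis by blast
qed

lemma outward_normal_unique:
  fixes K :: "'a::euclidean_space set"
  assumes "outward_normal \<nu> K S" "outward_normal \<mu> K S"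
    and "aff_dim S = DIM('a) - 1" "S \<noteq> {}" "interior K \<noteq> {}"
  shows "\<mu> = \<nu>"
proof (rule ccontr)
  assume "\<mu> \<noteq> \<nu>"
  then have "\<mu> = - \<nu>"
    using assms normal_unique_up_to_sign by (metis outward_normal_def)
  obtain y z where "y \<in> interior K" "z \<in> S" using assms(4,5) by blast
  then have "\<nu> \<bullet> (y - z) < 0" "\<mu> \<bullet> (y - z) < 0"
    using outward_normal_interior assms(1,2) by blast+
  with \<open>\<mu> = - \<nu>\<close> show False by simp
qed

text \<open>
  Push a point \<open>w\<close> away from an interior point \<open>y\<close> of \<open>K\<close> until it reaches the hyperplane of \<open>S\<close>.
  The projected point depends continuously on \<open>w\<close>, so it stays in \<open>S\<close> for \<open>w\<close> close to the
  relative interior point \<open>z\<close>, and \<open>w\<close> lies on the segment from it to \<open>y\<close>.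
\<close>

lemma one_sided_neighbourhood:
  fixes K :: "'a::euclidean_space set"
  assumes \<nu>: "outward_normal \<nu> K S" and "convex K" "interior K \<noteq> {}" "S \<subseteq> K"
    and S: "aff_dim S = DIM('a) - 1" and z: "z \<in> rel_interior S"
  shows "\<exists>e>0. \<forall>w\<in>ball z e. \<nu> \<bullet> (w - z) \<le> 0 \<longrightarrow> w \<in> K"
proof -
  obtain y where y: "y \<in> interior K" using assms by blast
  have "z \<in> S" using z rel_interior_subset by blast
  have "norm \<nu> = 1" using outward_normal_norm [OF \<nu>] .
  have hull: "affine hull S = {w. \<nu> \<bullet> w = \<nu> \<bullet> z}"
    using affine_hull_eq_normal_hyperplane \<nu> S \<open>z \<in> S\<close> by (metis outward_normal_def)
  define c where "c = - (\<nu> \<bullet> (y - z))"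
  have "c > 0" using outward_normal_interior [OF \<nu> \<open>z \<in> S\<close> y] by (simp add: c_def)
  \<comment> \<open>\<open>\<theta> w\<close> and \<open>\<pi> w\<close> solve \<open>w = (1 - \<theta>) \<pi> + \<theta> y\<close> with \<open>\<pi>\<close> in the hyperplane of \<open>S\<close>\<close>
  define \<theta> where "\<theta> = (\<lambda>w. - (\<nu> \<bullet> (w - z)) / c)"
  define \<pi> where "\<pi> = (\<lambda>w. (w - \<theta> w *\<^sub>R y) /\<^sub>R (1 - \<theta> w))"
  obtain e where e: "e > 0" "ball z e \<inter> affine hull S \<subseteq> S"
    using z by (auto simp: mem_rel_interior_ball)
  have "\<theta> z = 0" by (simp add: \<theta>_def)
  then have "\<pi> z = z" by (simp add: \<pi>_def)
  have "isCont \<theta> z" unfolding \<theta>_def using \<open>c > 0\<close> by (intro continuous_intros) auto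
  then have "isCont \<pi> z" unfolding \<pi>_def using \<open>\<theta> z = 0\<close> by (intro continuous_intros) auto
  then obtain d where d: "d > 0" "\<And>w. dist w z < d \<Longrightarrow> dist (\<pi> w) z < e"
    using \<open>\<pi> z = z\<close> \<open>e > 0\<close> by (metis continuous_at_eps_delta)
  show ?thesis
  proof (intro exI conjI ballI impI)
    show "min d c > 0" using \<open>d > 0\<close> \<open>c > 0\<close> by simp
    fix w assume w: "w \<in> ball z (min d c)" "\<nu> \<bullet> (w - z) \<le> 0"
    have "\<bar>\<nu> \<bullet> (w - z)\<bar> \<le> norm (w - z)"
      using Cauchy_Schwarz_ineq2 [of \<nu> "w - z"] \<open>norm \<nu> = 1\<close> by simp
    also have "\<dots> < c" using w by (simp add: dist_norm norm_minus_commute)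
    finally have \<theta>: "0 \<le> \<theta> w" "\<theta> w < 1" using w \<open>c > 0\<close> by (auto simp: \<theta>_def divide_simps)
    have w_eq: "w = (1 - \<theta> w) *\<^sub>R \<pi> w + \<theta> w *\<^sub>R y" using \<theta> by (simp add: \<pi>_def)
    have "\<nu> \<bullet> (w - z) = - \<theta> w * c" using \<open>c > 0\<close> by (simp add: \<theta>_def)
    moreover have "\<nu> \<bullet> (w - z) = (1 - \<theta> w) * (\<nu> \<bullet> (\<pi> w - z)) + \<theta> w * (\<nu> \<bullet> (y - z))"
      by (subst w_eq) (simp add: inner_simps algebra_simps)
    ultimately have "(1 - \<theta> w) * (\<nu> \<bullet> (\<pi> w - z)) = 0" by (simp add: c_def)
    then have "\<pi> w \<in> affine hull S" using \<theta> by (simp add: hull inner_diff_right)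
    moreover have "\<pi> w \<in> ball z e" using d(2) [of w] w by (simp add: dist_commute)
    ultimately have "\<pi> w \<in> K" using e \<open>S \<subseteq> K\<close> by blast
    then have "(1 - \<theta> w) *\<^sub>R \<pi> w + \<theta> w *\<^sub>R y \<in> K"
      using \<open>convex K\<close> y interior_subset \<theta> by (intro convexD) auto
    then show "w \<in> K" using w_eq by simp
  qed
qed

lemma equal_normals_imp_interiors_meet:
  fixes K1 K2 :: "'a::euclidean_space set"
  assumes "outward_normal \<nu> K1 S" "convex K1" "interior K1 \<noteq> {}" "S \<subseteq> K1"
    and "outward_normal \<nu> K2 S" "convex K2" "interior K2 \<noteq> {}" "S \<subseteq> K2"
    and "aff_dim S = DIM('a) - 1" "z \<in> rel_interior S"
  shows "interior K1 \<inter> interior K2 \<noteq> {}"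
proof -
  obtain e1 where e1: "e1 > 0" "\<And>w. w \<in> ball z e1 \<Longrightarrow> \<nu> \<bullet> (w - z) \<le> 0 \<Longrightarrow> w \<in> K1"
    using one_sided_neighbourhood [of \<nu> K1 S z] assms by blast
  obtain e2 where e2: "e2 > 0" "\<And>w. w \<in> ball z e2 \<Longrightarrow> \<nu> \<bullet> (w - z) \<le> 0 \<Longrightarrow> w \<in> K2"
    using one_sided_neighbourhood [of \<nu> K2 S z] assms by blast
  let ?e = "min e1 e2"
  let ?H = "ball z ?e \<inter> {w. \<nu> \<bullet> w < \<nu> \<bullet> z}"
  have "norm \<nu> = 1" using outward_normal_norm [OF assms(1)] .
  then have "z - (?e / 2) *\<^sub>R \<nu> \<in> ?H"
    using e1(1) e2(1) by (auto simp: dist_norm inner_diff_right dot_square_norm)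
  moreover have "open ?H" by (intro open_Int open_ball open_halfspace_lt)
  moreover have "?H \<subseteq> K1 \<inter> K2" using e1(2) e2(2) by (simp add: subset_iff inner_diff_right)
  ultimately have "interior (K1 \<inter> K2) \<noteq> {}"
    by (metis empty_iff interior_maximal subset_empty)
  then show ?thesis by simp
qed

lemma opposite_normals_imp_interior_Un:
  fixes K1 K2 :: "'a::euclidean_space set"
  assumes "outward_normal \<nu> K1 S" "convex K1" "interior K1 \<noteq> {}" "S \<subseteq> K1"
    and "outward_normal (- \<nu>) K2 S" "convex K2" "interior K2 \<noteq> {}" "S \<subseteq> K2"
    and "aff_dim S = DIM('a) - 1" "z \<in> rel_interior S"
  shows "z \<in> interior (K1 \<union> K2)"
proof -
  obtain e1 where e1: "e1 > 0" "\<And>w. w \<in> ball z e1 \<Longrightarrow> \<nu> \<bullet> (w - z) \<le> 0 \<Longrightarrow> w \<in> K1"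
    using one_sided_neighbourhood [of \<nu> K1 S z] assms by blast
  obtain e2 where e2: "e2 > 0" "\<And>w. w \<in> ball z e2 \<Longrightarrow> - \<nu> \<bullet> (w - z) \<le> 0 \<Longrightarrow> w \<in> K2"
    using one_sided_neighbourhood [of "- \<nu>" K2 S z] assms by blast
  have "ball z (min e1 e2) \<subseteq> K1 \<union> K2"
  proof
    fix w assume "w \<in> ball z (min e1 e2)"
    then show "w \<in> K1 \<union> K2"
      using e1(2) [of w] e2(2) [of w] by (cases "\<nu> \<bullet> (w - z) \<le> 0") auto
  qed
  then show ?thesis using e1(1) e2(1) by (auto simp: mem_interior intro!: exI [of _ "min e1 e2"])
qed

text \<open>
  This justifies the definite description in \<open>unit_normal\<close>: faces of polyhedra are exposed,
  which gives existence, and an interior point of the simplex fixes the sign.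
\<close>

lemma unit_normal_outward:
  fixes K :: "'d::finite spacetime set"
  assumes "polyhedron K" "interior K \<noteq> {}" "S facet_of K"
    and "aff_dim S = DIM('d spacetime) - 1"
  shows "outward_normal (unit_normal K S) K S"
proof -
  have "\<exists>!\<nu>. outward_normal \<nu> K S"
    using outward_normal_exists outward_normal_unique assms by (metis facet_of_def)
  then show ?thesis
    unfolding unit_normal_def outward_normal_def normal_to_def conj_assoc by (rule theI')
qed

section \<open>Facets in a conforming mesh\<close>

lemma slab_mesh_simplex:
  fixes K :: "'d::finite spacetime set"
  assumes "slab_mesh E TT" "K \<in> TT"
  shows "polytope K" "convex K" "compact K" "aff_dim K = DIM('d spacetime)"
    "interior K \<noteq> {}" "rel_interior K = interior K" "closure (interior K) = K"
    "finite (lateral_facets K)"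
proof -
  have K: "(int CARD('d) + 1) simplex K" using assms by (simp add: slab_mesh_def)
  then show K1: "polytope K" "convex K" "compact K"
    using simplex_imp_polytope polytope_imp_convex polytope_imp_compact by blast+
  show K2: "aff_dim K = DIM('d spacetime)" using aff_dim_simplex [OF K] by simp
  then show K3: "rel_interior K = interior K" by (rule interior_rel_interior)
  have "K \<noteq> {}" using K2 by auto
  then show "interior K \<noteq> {}" using K1 K3 rel_interior_eq_empty by metis
  then show "closure (interior K) = K"
    using K1 convex_closure_interior closure_closed compact_imp_closed by metis
  show "finite (lateral_facets K)"
    unfolding lateral_facets_def using finite_polytope_facets [OF K1(1)] by simp
qed

lemma slab_mesh_facet:
  fixes K :: "'d::finite spacetime set"
  assumes "slab_mesh E TT" "K \<in> TT" "S facet_of K"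
  shows "polytope S" "convex S" "compact S" "S \<subseteq> K" "S \<noteq> {}" "aff_dim S = DIM('d spacetime) - 1"
    "closure (rel_interior S) = S" "rel_interior S \<noteq> {}" "outward_normal (unit_normal K S) K S"
proof -
  note K = slab_mesh_simplex [OF assms(1,2)]
  have face: "S face_of K" using assms(3) by (simp add: facet_of_def)
  show S: "polytope S" "S \<subseteq> K"
    using face_of_polytope_polytope [OF K(1) face] face_of_imp_subset [OF face] .
  show S'': "S \<noteq> {}" "aff_dim S = DIM('d spacetime) - 1"
    using assms(3) K(4) by (simp_all add: facet_of_def)
  show S': "convex S" "compact S"
    using S(1) polytope_imp_convex polytope_imp_compact by blast+
  then show "closure (rel_interior S) = S"
    using convex_closure_rel_interior closure_closed compact_imp_closed by metis
  show "rel_interior S \<noteq> {}" using S'' S' rel_interior_eq_empty by blast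
  show "outward_normal (unit_normal K S) K S"
    using unit_normal_outward [OF polytope_imp_polyhedron [OF K(1)] K(5) assms(3) S''(2)] .
qed

lemma slab_mesh_face_Int:
  assumes "slab_mesh E TT" "K \<in> TT" "K' \<in> TT"
  shows "(K \<inter> K') face_of K" "(K \<inter> K') face_of K'"
  using assms unfolding slab_mesh_def triangulation_def by (metis Int_commute)+

text \<open>
  The intersection of two simplices is a face of each.  A face that meets the interior is the whole
  simplex, so the one would be a face of the other, of the same dimension.
\<close>

lemma slab_mesh_interiors_disjoint:
  assumes m: "slab_mesh E TT" and K: "K \<in> TT" "K' \<in> TT" "K \<noteq> K'"
  shows "interior K \<inter> K' = {}"
proof (rule ccontr)
  assume "interior K \<inter> K' \<noteq> {}"
  then have "(K \<inter> K') \<inter> rel_interior K \<noteq> {}"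
    using slab_mesh_simplex [OF m K(1)] interior_subset by blast
  then have "K \<subseteq> K \<inter> K'"
    using subset_of_face_of slab_mesh_face_Int [OF m K(1,2)] by blast
  then have "K face_of K'"
    using slab_mesh_face_Int [OF m K(1,2)] by (metis Int_absorb2 inf.boundedE)
  then have "aff_dim K < aff_dim K'"
    using face_of_aff_dim_lt slab_mesh_simplex [OF m K(2)] K(3) by blast
  then show False
    using slab_mesh_simplex [OF m K(1)] slab_mesh_simplex [OF m K(2)] by simp
qed

text \<open>
  A facet pressure supported on the relative interior of one facet thus vanishes identically on
  all other facets, including those of the neighbouring simplices.  The reason is the
  conformity of the mesh: a facet that meets a face of a neighbour in its relative interior
  lies inside that face.
\<close>

lemma facet_rel_interior_disjoint:
  assumes m: "slab_mesh E TT" and K: "K \<in> TT" "S facet_of K"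
    and K': "K' \<in> TT" "S' facet_of K'" and "S \<noteq> S'"
  shows "rel_interior S \<inter> S' = {}"
proof (rule ccontr)
  assume meet: "rel_interior S \<inter> S' \<noteq> {}"
  note S = slab_mesh_facet [OF m K] and S' = slab_mesh_facet [OF m K']
  have "(K \<inter> K') \<inter> rel_interior S \<noteq> {}"
    using meet S S' rel_interior_subset by blast
  then have "S \<subseteq> K \<inter> K'"
    using subset_of_face_of slab_mesh_face_Int [OF m K(1) K'(1)] S by blast
  then have "S face_of K'"
    using K slab_mesh_face_Int [OF m K(1) K'(1)]
    by (metis face_of_subset face_of_trans facet_of_def inf_le1)
  moreover have "S \<subseteq> S'"
    using subset_of_face_of [of S' K' S] meet K' calculation
    by (auto simp: facet_of_def dest: face_of_imp_subset)
  ultimately have "S face_of S'"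
    using S' by (metis face_of_subset)
  then have "aff_dim S < aff_dim S'" using face_of_aff_dim_lt S' \<open>S \<noteq> S'\<close> by blast
  then show False using S S' by simp
qed

text \<open>
  With equal normals, both simplices would contain the same half of a small ball.
\<close>

lemma shared_facet_opposite_normals:
  assumes m: "slab_mesh E TT" and K1: "K1 \<in> TT" "S facet_of K1"
    and K2: "K2 \<in> TT" "S facet_of K2" and "K1 \<noteq> K2"
  shows "unit_normal K2 S = - unit_normal K1 S"
proof (rule ccontr)
  assume no: "unit_normal K2 S \<noteq> - unit_normal K1 S"
  note S1 = slab_mesh_facet [OF m K1] and S2 = slab_mesh_facet [OF m K2]
  have "unit_normal K2 S = unit_normal K1 S"
    using normal_unique_up_to_sign S1 S2 no by (metis outward_normal_def)
  moreover obtain z where "z \<in> rel_interior S" using S1 by blast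
  ultimately have "interior K1 \<inter> interior K2 \<noteq> {}"
    using equal_normals_imp_interiors_meet [of "unit_normal K1 S" K1 S K2 z]
      S1 S2 slab_mesh_simplex [OF m K1(1)] slab_mesh_simplex [OF m K2(1)] by simp
  then show False
    using slab_mesh_interiors_disjoint [OF m K1(1) K2(1) \<open>K1 \<noteq> K2\<close>] interior_subset by blast
qed

text \<open>
  Three nonzero vectors cannot be pairwise opposite.
\<close>

lemma facet_shared_by_at_most_two:
  assumes m: "slab_mesh E TT" and K1: "K1 \<in> TT" "S facet_of K1"
    and K2: "K2 \<in> TT" "S facet_of K2" and "K1 \<noteq> K2" and K: "K \<in> TT" "S facet_of K"
  shows "K = K1 \<or> K = K2"
proof (rule ccontr)
  assume "\<not> (K = K1 \<or> K = K2)"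
  then have e1: "unit_normal K S = - unit_normal K1 S"
    and e2: "unit_normal K S = - unit_normal K2 S"
    using shared_facet_opposite_normals m K K1 K2 by blast+
  have "unit_normal K2 S = - unit_normal K1 S"
    using shared_facet_opposite_normals m K1 K2 \<open>K1 \<noteq> K2\<close> by blast
  moreover have "unit_normal K2 S = unit_normal K1 S"
    using trans [OF e2 [symmetric] e1] by (simp only: neg_equal_iff_equal)
  ultimately have "unit_normal K1 S = - unit_normal K1 S"
    by (metis (no_types))
  then have "unit_normal K1 S + unit_normal K1 S = 0" by (simp only: eq_neg_iff_add_eq_0)
  then have "2 *\<^sub>R unit_normal K1 S = 0" by (simp only: scaleR_2)
  then have "unit_normal K1 S = 0" by simp
  moreover have "norm (unit_normal K1 S) = 1"
    using slab_mesh_facet(9) [OF m K1] by (rule outward_normal_norm)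
  ultimately show False by simp
qed

text \<open>
  Two opposite half balls would make up a ball inside the union of the mesh, whose interior is the
  open set \<open>E\<close>; but an open set does not meet its frontier.
\<close>

lemma frontier_facet_not_shared:
  assumes m: "slab_mesh E TT" and K1: "K1 \<in> TT" "S facet_of K1"
    and K2: "K2 \<in> TT" "S facet_of K2" and S: "S \<subseteq> frontier E"
  shows "K1 = K2"
proof (rule ccontr)
  assume "K1 \<noteq> K2"
  note S1 = slab_mesh_facet [OF m K1] and S2 = slab_mesh_facet [OF m K2]
  obtain z where z: "z \<in> rel_interior S" using S1 by blast
  have "outward_normal (- unit_normal K1 S) K2 S"
    using S2(9) shared_facet_opposite_normals [OF m K1 K2 \<open>K1 \<noteq> K2\<close>] by metis
  then have "z \<in> interior (K1 \<union> K2)"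
    using opposite_normals_imp_interior_Un [OF S1(9) _ _ S1(4) _ _ _ S2(4) S1(6) z]
      slab_mesh_simplex(2,5) [OF m K1(1)] slab_mesh_simplex(2,5) [OF m K2(1)] by blast
  moreover have E: "interior (\<Union>TT) = E" using m unfolding slab_mesh_def by blast
  moreover have "interior (K1 \<union> K2) \<subseteq> interior (\<Union>TT)"
    using K1(1) K2(1) by (intro interior_mono) blast
  ultimately have "z \<in> interior E" by (metis interior_interior subsetD)
  moreover have "z \<in> frontier E" using z S rel_interior_subset by blast
  ultimately show False by (simp add: frontier_def)
qed

section \<open>Integrals over facets\<close>

text \<open>
  The affine hull of a facet is a translate of a subspace of dimension \<open>CARD('d)\<close>, hence isometric
  to \<open>real ^ 'd\<close>; so the choice in \<open>flat_chart\<close> is not vacuous.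
\<close>

lemma flat_chart_isometry:
  fixes S :: "'d::finite spacetime set"
  assumes S: "aff_dim S = DIM('d spacetime) - 1" "S \<noteq> {}"
  shows "dist (flat_chart S x) (flat_chart S y) = dist x y" "range (flat_chart S) = affine hull S"
proof -
  obtain z where "z \<in> S" using S by blast
  then have z: "z \<in> affine hull S" by (simp add: hull_inc)
  define L where "L = (\<lambda>x. - z + x) ` (affine hull S)"
  have L: "subspace L" unfolding L_def by (intro affine_diffs_subspace z affine_affine_hull)
  have "int (dim L) = int CARD('d)"
    using aff_dim_eq_dim [of z "affine hull S"] z S unfolding L_def by (simp add: hull_hull)
  then have "dim (UNIV :: (real ^ 'd) set) = dim L" by (simp add: dim_UNIV)
  then obtain f where f: "linear f" "f ` (UNIV :: (real ^ 'd) set) = L" "\<And>x. norm (f x) = norm x"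
    using isometries_subspaces [OF subspace_UNIV L] by (metis UNIV_I)
  have "dist (z + f x) (z + f y) = dist x y" for x y
    using f(3) [of "x - y"] by (simp add: dist_norm linear_diff [OF f(1)])
  moreover have "range (\<lambda>x. z + f x) = affine hull S"
  proof -
    have "range (\<lambda>x. z + f x) = (\<lambda>x. z + x) ` L" by (simp flip: f(2) add: image_image)
    then show ?thesis by (simp add: L_def image_image)
  qed
  ultimately have "\<exists>\<Phi>. (\<forall>x y. dist (\<Phi> x) (\<Phi> y) = dist (x :: real ^ 'd) y) \<and> range \<Phi> = affine hull S"
    by (intro exI [of _ "\<lambda>x. z + f x"]) simp
  from someI_ex [OF this] show
    "dist (flat_chart S x) (flat_chart S y) = dist x y" "range (flat_chart S) = affine hull S"
    unfolding flat_chart_def by blast+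
qed

context
  fixes S :: "'d::finite spacetime set"
  assumes S: "aff_dim S = DIM('d spacetime) - 1" "S \<noteq> {}" "bounded S"
begin

lemma continuous_flat_chart: "continuous_on A (flat_chart S)"
  unfolding continuous_on_iff by (metis flat_chart_isometry(1) [OF S(1,2)])

lemma flat_chart_measurable: "flat_chart S \<in> borel_measurable borel"
  by (intro borel_measurable_continuous_onI continuous_flat_chart)

lemma bounded_chart_domain: "bounded (flat_chart S -` rel_interior S)"
proof (cases "flat_chart S -` rel_interior S = {}")
  case False
  then obtain x where "flat_chart S x \<in> rel_interior S" by blast
  obtain e where e: "\<And>w. w \<in> S \<Longrightarrow> dist (flat_chart S x) w \<le> e"
    using \<open>bounded S\<close> by (meson bounded_any_center)
  have "dist x y \<le> e" if "flat_chart S y \<in> rel_interior S" for y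
    using e [OF subsetD [OF rel_interior_subset that]]
    by (simp only: flat_chart_isometry(1) [OF S(1,2)])
  then show ?thesis unfolding bounded_def by blast
qed simp

lemma open_chart_domain: "open (flat_chart S -` rel_interior S)"
proof -
  obtain V where V: "open V" "rel_interior S = affine hull S \<inter> V"
    using openin_rel_interior [of S] by (auto simp: openin_open)
  then have "flat_chart S -` rel_interior S = flat_chart S -` V"
    using flat_chart_isometry(2) [OF S(1,2)] by blast
  then show ?thesis
    using V continuous_flat_chart [of UNIV] by (simp add: open_vimage)
qed

text \<open>
  Integrands are cut off to the relative interior of the facet: the values of a facet velocity on
  the relative boundary are arbitrary and need not be measurable.
\<close>

lemma rel_interior_borel: "rel_interior S \<in> sets borel"
proof -
  obtain V where V: "open V" "rel_interior S = affine hull S \<inter> V"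
    using openin_rel_interior [of S] by (auto simp: openin_open)
  then show ?thesis by (simp add: closed_affine_hull sets.Int borel_closed borel_open)
qed

lemma surface_integrable:
  fixes g :: "'d spacetime \<Rightarrow> real"
  assumes g: "continuous_on UNIV g"
  shows "integrable (surface_measure S) (\<lambda>z. indicator (rel_interior S) z * g z)"
proof -
  let ?\<Phi> = "flat_chart S" and ?U = "flat_chart S -` rel_interior S"
  have m: "(\<lambda>z. indicator (rel_interior S) z * g z) \<in> borel_measurable borel"
    using rel_interior_borel borel_measurable_continuous_onI [OF g] by simp
  have c: "continuous_on A (\<lambda>x. g (?\<Phi> x))" for A
    using continuous_on_compose2 [OF g continuous_flat_chart] by simp
  have "integrable lborel (\<lambda>x. indicator (closure ?U) x *\<^sub>R g (?\<Phi> x))"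
    by (intro borel_integrable_compact c) (use bounded_chart_domain in auto)
  then have "integrable lborel (\<lambda>x. indicator ?U x * g (?\<Phi> x))"
  proof (rule Bochner_Integration.integrable_bound)
    show "(\<lambda>x. indicator ?U x * g (?\<Phi> x)) \<in> borel_measurable lborel"
      unfolding measurable_lborel2
      by (intro borel_measurable_times borel_measurable_indicator borel_open open_chart_domain
          borel_measurable_continuous_onI c)
  qed (use closure_subset [of ?U] in \<open>auto simp: indicator_def\<close>)
  then have "integrable (distr lborel borel ?\<Phi>) (\<lambda>z. indicator (rel_interior S) z * g z)"
    using flat_chart_measurable m by (subst integrable_distr_eq) (auto simp: indicator_def)
  then show ?thesis
    unfolding surface_measure_def using m by (subst integrable_completion) auto
qed

lemma zero_of_surface_integral_square:
  fixes g :: "'d spacetime \<Rightarrow> real"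
  assumes g: "continuous_on UNIV g"
    and zero: "(LINT z|surface_measure S. indicator (rel_interior S) z * (g z)\<^sup>2) = 0"
    and z: "z \<in> rel_interior S"
  shows "g z = 0"
proof -
  let ?\<Phi> = "flat_chart S" and ?U = "flat_chart S -` rel_interior S"
  have m: "(\<lambda>z. indicator (rel_interior S) z * (g z)\<^sup>2) \<in> borel_measurable borel"
    using rel_interior_borel borel_measurable_continuous_onI [OF g] by simp
  have "(LINT x|lborel. indicator ?U x * (g (?\<Phi> x))\<^sup>2) =
      (LINT z|distr lborel borel ?\<Phi>. indicator (rel_interior S) z * (g z)\<^sup>2)"
    using flat_chart_measurable m by (subst integral_distr) (auto simp: indicator_def)
  also have "\<dots> = 0"
    using zero m unfolding surface_measure_def by (subst (asm) integral_completion) auto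
  finally have zero': "(LINT x|lborel. indicator ?U x * (g (?\<Phi> x))\<^sup>2) = 0" .
  have "continuous_on UNIV (\<lambda>x. g (?\<Phi> x))"
    using continuous_on_compose2 [OF g continuous_flat_chart] by simp
  note vanish = continuous_zero_of_integral_square
    [OF open_chart_domain bounded_chart_domain this zero']
  have "z \<in> range ?\<Phi>"
    unfolding flat_chart_isometry(2) [OF S(1,2)]
    using z rel_interior_subset hull_subset by (metis subsetD)
  then obtain x where "z = ?\<Phi> x" by blast
  then show ?thesis using z vanish [of x] by simp
qed

end

section \<open>Traces and divergence of broken polynomials\<close>

lemma trace_eq_continuous_extension:
  fixes v P :: "'d::finite spacetime \<Rightarrow> 'b::t2_space"
  assumes m: "slab_mesh E TT" "K \<in> TT" and P: "continuous_on UNIV P"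
    and eq: "\<And>x. x \<in> interior K \<Longrightarrow> v x = P x" and "z \<in> K"
  shows "tr K v z = P z"
  unfolding tr_def
proof (rule tendsto_Lim)
  note K = slab_mesh_simplex [OF m]
  have "K \<noteq> {z}" using K(4) by auto
  then have "z islimpt K"
    using connected_imp_perfect convex_connected K(2) \<open>z \<in> K\<close> by blast
  then have "z islimpt interior K" using K(7) limpt_of_closure by metis
  then show "at z within interior K \<noteq> bot" by (simp add: trivial_limit_within)
  have "(P \<longlongrightarrow> P z) (at z within UNIV)"
    using P unfolding continuous_on_def by blast
  then have "(P \<longlongrightarrow> P z) (at z within interior K)"
    by (rule tendsto_within_subset) simp
  moreover have "\<forall>\<^sub>F x in at z within interior K. P x = v x"
    using eq by (auto simp: eventually_at_filter)
  ultimately show "(v \<longlongrightarrow> P z) (at z within interior K)"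
    using tendsto_cong by blast
qed

lemma broken_polynomial_trace:
  fixes u :: "'d::finite spacetime \<Rightarrow> real ^ 'd"
  assumes m: "slab_mesh E TT" "K \<in> TT" and u: "u \<in> Vh k TT"
  shows "\<exists>p. (\<forall>i. p i \<in> polys k) \<and> (\<forall>z\<in>K. tr K u z = (\<chi> i. p i z))"
proof -
  obtain p where p: "\<And>i. p i \<in> polys k" "\<And>i z. z \<in> interior K \<Longrightarrow> u z $ i = p i z"
    using u m unfolding Vh_def by (simp add: Bex_def) metis
  have "tr K u z = (\<chi> i. p i z)" if "z \<in> K" for z
  proof (rule trace_eq_continuous_extension [OF m _ _ that])
    show "continuous_on UNIV (\<lambda>z. \<chi> i. p i z)"
      by (intro continuous_on_vec_lambda polys_continuous_on [OF p(1)])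
  qed (simp add: p(2) vec_eq_iff)
  then show ?thesis using p(1) by (intro exI [of _ p]) simp
qed

lemma trace_continuous_on:
  fixes u :: "'d::finite spacetime \<Rightarrow> real ^ 'd"
  assumes m: "slab_mesh E TT" "K \<in> TT" and u: "u \<in> Vh k TT"
  shows "continuous_on K (tr K u)"
proof -
  obtain p where p: "\<And>i. p i \<in> polys k" "\<And>z. z \<in> K \<Longrightarrow> tr K u z = (\<chi> i. p i z)"
    using broken_polynomial_trace [OF m u] by blast
  have "continuous_on K (\<lambda>z. \<chi> i. p i z)"
    by (intro continuous_on_vec_lambda polys_continuous_on [OF p(1)])
  then show ?thesis using p(2) by (simp cong: continuous_on_cong)
qed

lemma divg_of_components:
  fixes v :: "'d::finite spacetime \<Rightarrow> real ^ 'd"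
  assumes p: "\<And>i. p i \<in> polys l" and "open U" "z \<in> U"
    and eq: "\<And>i x. x \<in> U \<Longrightarrow> v x $ i = p i x"
  shows "divg v z = (\<Sum>i\<in>UNIV. frechet_derivative (p i) (at z) (0, axis i 1))"
proof -
  have B: "(0, axis i 1) \<in> (Basis :: 'd spacetime set)" for i
    by (simp add: Basis_prod_def axis_in_Basis_iff)
  have "p i differentiable at z" for i
    using polys_derivative(1) [OF p B] .
  then have "((\<lambda>x. \<chi> i. p i x) has_derivative (\<lambda>y. \<chi> i. frechet_derivative (p i) (at z) y)) (at z)"
    by (subst has_derivative_componentwise_within)
      (auto simp: Basis_vec_def inner_axis frechet_derivative_works)
  then have "(v has_derivative (\<lambda>y. \<chi> i. frechet_derivative (p i) (at z) y)) (at z)"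
    by (rule has_derivative_transform_within_open [OF _ \<open>open U\<close> \<open>z \<in> U\<close>])
      (simp add: vec_eq_iff eq)
  then have "frechet_derivative v (at z) = (\<lambda>y. \<chi> i. frechet_derivative (p i) (at z) y)"
    by (rule frechet_derivative_at [symmetric])
  then show ?thesis
    by (simp add: divg_def trace_def grad_def)
qed

lemma divergence_polynomial:
  fixes u :: "'d::finite spacetime \<Rightarrow> real ^ 'd"
  assumes "u \<in> Vh k TT" "K \<in> TT"
  shows "\<exists>D\<in>polys (k - 1). \<forall>z\<in>interior K. divg u z = D z"
proof -
  obtain p where p: "\<And>i. p i \<in> polys k" "\<And>i z. z \<in> interior K \<Longrightarrow> u z $ i = p i z"
    using assms unfolding Vh_def by (simp add: Bex_def) metis
  have B: "(0, axis i 1) \<in> (Basis :: 'd spacetime set)" for i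
    by (simp add: Basis_prod_def axis_in_Basis_iff)
  show ?thesis
  proof (intro bexI ballI)
    show "(\<lambda>z. \<Sum>i\<in>UNIV. frechet_derivative (p i) (at z) (0, axis i 1)) \<in> polys (k - 1)"
      by (intro polys_sum polys_derivative(2) p B)
  qed (rule divg_of_components [OF p(1) open_interior], use p(2) in auto)
qed

section \<open>Testing the continuity equation\<close>

lemma zero_in_Qh: "(\<lambda>_. 0) \<in> Qh k TT"
  unfolding Qh_def by (intro CollectI ballI bexI [OF _ polys_zero] refl)

lemma zero_in_Qbarh: "(\<lambda>_. 0) \<in> Qbarh k TT"
  unfolding Qbarh_def by (intro CollectI ballI bexI [OF _ polys_zero] refl)

text \<open>
  The test pressure is the divergence itself, cut off to the interior of \<open>K\<close>: since the interior of
  \<open>K\<close> is disjoint from all other simplices, no other simplex contributes.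
\<close>

lemma divergence_free_of_continuity_equation:
  fixes u ub :: "'d::finite spacetime \<Rightarrow> real ^ 'd"
  assumes m: "slab_mesh E TT" and u: "u \<in> Vh k TT"
    and zero: "\<And>Q. Q \<in> Xq k TT \<Longrightarrow> bh TT Q (u, ub) = 0"
    and K: "K \<in> TT" and z: "z \<in> interior K"
  shows "divg u z = 0"
proof -
  have "finite TT" using m by (simp add: slab_mesh_def triangulation_def)
  obtain D where D: "D \<in> polys (k - 1)" "\<And>z. z \<in> interior K \<Longrightarrow> divg u z = D z"
    using divergence_polynomial [OF u K] by blast
  define q where "q = (\<lambda>z. if z \<in> interior K then D z else 0)"
  have "q \<in> Qh k TT"
    unfolding Qh_def
  proof (intro CollectI ballI)
    fix K' assume K': "K' \<in> TT"
    show "\<exists>p\<in>polys (k - 1). \<forall>z\<in>interior K'. q z = p z"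
    proof (cases "K' = K")
      case True
      then show ?thesis using D(1) by (auto simp: q_def)
    next
      case False
      then have "\<forall>z\<in>interior K'. q z = 0"
        using slab_mesh_interiors_disjoint [OF m K K'] interior_subset [of K'] by (auto simp: q_def)
      then show ?thesis by (intro bexI [OF _ polys_zero])
    qed
  qed
  then have "(q, \<lambda>_. 0) \<in> Xq k TT"
    by (simp add: Xq_def zero_in_Qbarh)
  then have "(\<Sum>K'\<in>TT. LINT z:K'|lebesgue. q z * divg u z) = 0"
    using zero [of "(q, \<lambda>_. 0)"] by (simp add: bh_def lateral_integral_def set_lebesgue_integral_def)
  also have "(\<Sum>K'\<in>TT. LINT z:K'|lebesgue. q z * divg u z) =
      (\<Sum>K'\<in>TT. if K' = K then LINT z|lebesgue. indicator (interior K) z * (D z)\<^sup>2 else 0)"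
  proof (intro sum.cong refl)
    fix K' assume K': "K' \<in> TT"
    have "indicator K' z *\<^sub>R (q z * divg u z) =
      (if K' = K then indicator (interior K) z * (D z)\<^sup>2 else 0)" for z
      using D(2) slab_mesh_interiors_disjoint [OF m K K'] interior_subset [of K]
      by (auto simp: q_def indicator_def power2_eq_square)
    then show "(LINT z:K'|lebesgue. q z * divg u z) =
      (if K' = K then LINT z|lebesgue. indicator (interior K) z * (D z)\<^sup>2 else 0)"
      by (simp add: set_lebesgue_integral_def)
  qed
  also have "\<dots> = (LINT z|lebesgue. indicator (interior K) z * (D z)\<^sup>2)"
    using \<open>finite TT\<close> K by simp
  also have "\<dots> = (LINT z|lborel. indicator (interior K) z * (D z)\<^sup>2)"
    using borel_measurable_continuous_onI [OF polys_continuous_on [OF D(1)]]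
    by (intro integral_completion) (simp add: borel_open)
  finally have "D z = 0"
    using continuous_zero_of_integral_square [OF open_interior _ polys_continuous_on [OF D(1)] _ z]
      bounded_subset [OF compact_imp_bounded [OF slab_mesh_simplex(3) [OF m K]] interior_subset]
    by simp
  then show ?thesis using D(2) z by simp
qed

lemma facet_flux_polynomial:
  fixes u ub :: "'d::finite spacetime \<Rightarrow> real ^ 'd"
  assumes m: "slab_mesh E TT" and u: "u \<in> Vh k TT" and ub: "ub \<in> Vbarh k bD TT"
    and K: "K \<in> TT" and S: "S \<in> mesh_facets TT" "S \<subseteq> K"
  shows "\<exists>g\<in>polys k. \<forall>z\<in>rel_interior S. (tr K u z - ub z) \<bullet> a = g z"
proof -
  obtain p where p: "\<And>i. p i \<in> polys k" "\<And>z. z \<in> K \<Longrightarrow> tr K u z = (\<chi> i. p i z)"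
    using broken_polynomial_trace [OF m K u] by blast
  obtain r where r: "\<And>i. r i \<in> polys k" "\<And>i z. z \<in> rel_interior S \<Longrightarrow> ub z $ i = r i z"
    using ub S unfolding Vbarh_def by (simp add: Bex_def) metis
  have "(tr K u z - ub z) \<bullet> a = (\<Sum>i\<in>UNIV. a $ i * p i z + (- a $ i) * r i z)"
    if z: "z \<in> rel_interior S" for z
  proof -
    have "z \<in> K" using z S rel_interior_subset by blast
    then have diff: "tr K u z $ i - ub z $ i = p i z - r i z" for i
      using r(2) [OF z] p(2) by simp
    show ?thesis
      unfolding inner_vec_def vector_minus_component diff by (simp add: algebra_simps)
  qed
  moreover have "(\<lambda>z. \<Sum>i\<in>UNIV. a $ i * p i z + (- a $ i) * r i z) \<in> polys k"
    by (intro polys_sum polys_add polys_scale p r)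
  ultimately show ?thesis by (intro bexI [rotated]) auto
qed

text \<open>
  Testing with \<open>qb = G\<close> on the relative interior of \<open>S\<close>, where \<open>G\<close> is the sum in question, turns
  the continuity equation into the vanishing of the integral of \<open>G\<^sup>2\<close> over \<open>S\<close>.
\<close>

lemma facet_flux_balance:
  fixes u ub :: "'d::finite spacetime \<Rightarrow> real ^ 'd"
  assumes m: "slab_mesh E TT" and u: "u \<in> Vh k TT" and ub: "ub \<in> Vbarh k bD TT"
    and zero: "\<And>Q. Q \<in> Xq k TT \<Longrightarrow> bh TT Q (u, ub) = 0"
    and S: "S \<in> mesh_facets TT" and z: "z \<in> rel_interior S"
  shows "(\<Sum>K\<in>{K \<in> TT. S \<in> lateral_facets K}. (tr K u z - ub z) \<bullet> snd (unit_normal K S)) = 0"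
proof -
  let ?N = "{K \<in> TT. S \<in> lateral_facets K}"
  have "finite TT" using m by (simp add: slab_mesh_def triangulation_def)
  obtain K0 where K0: "K0 \<in> TT" "S facet_of K0"
    using S by (auto simp: mesh_facets_def lateral_facets_def)
  note S0 = slab_mesh_facet [OF m K0]
  have "\<forall>K\<in>?N. \<exists>g. g \<in> polys k \<and>
      (\<forall>z\<in>rel_interior S. (tr K u z - ub z) \<bullet> snd (unit_normal K S) = g z)"
  proof
    fix K assume "K \<in> ?N"
    then have "K \<in> TT" "S \<subseteq> K" using facet_of_imp_subset by (auto simp: lateral_facets_def)
    then show "\<exists>g. g \<in> polys k \<and>
        (\<forall>z\<in>rel_interior S. (tr K u z - ub z) \<bullet> snd (unit_normal K S) = g z)"
      using facet_flux_polynomial [OF m u ub _ S] by blast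
  qed
  from bchoice [OF this] obtain g where
    "\<forall>K\<in>?N. g K \<in> polys k \<and>
      (\<forall>z\<in>rel_interior S. (tr K u z - ub z) \<bullet> snd (unit_normal K S) = g K z)" ..
  then have g: "\<And>K. K \<in> ?N \<Longrightarrow> g K \<in> polys k"
    "\<And>K z. K \<in> ?N \<Longrightarrow> z \<in> rel_interior S \<Longrightarrow>
      (tr K u z - ub z) \<bullet> snd (unit_normal K S) = g K z"
    by blast+
  define G where "G = (\<lambda>z. \<Sum>K\<in>?N. g K z)"
  have G: "G \<in> polys k" unfolding G_def by (intro polys_sum g)
  define qb where "qb = (\<lambda>z. if z \<in> rel_interior S then G z else 0)"
  have off: "qb z = 0" if "K \<in> TT" "S' \<in> lateral_facets K" "S' \<noteq> S" "z \<in> S'" for K S' z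
    using facet_rel_interior_disjoint [OF m K0, of K S'] that
    by (auto simp: qb_def lateral_facets_def)
  have "qb \<in> Qbarh k TT"
    unfolding Qbarh_def
  proof (intro CollectI ballI)
    fix S' assume S': "S' \<in> mesh_facets TT"
    show "\<exists>p\<in>polys k. \<forall>z\<in>rel_interior S'. qb z = p z"
    proof (cases "S' = S")
      case True
      then show ?thesis using G by (auto simp: qb_def)
    next
      case False
      then have "\<forall>z\<in>rel_interior S'. qb z = 0"
        using S' off rel_interior_subset unfolding mesh_facets_def by blast
      then show ?thesis by (intro bexI [OF _ polys_zero])
    qed
  qed
  then have "((\<lambda>_. 0), qb) \<in> Xq k TT"
    by (simp add: Xq_def zero_in_Qh)
  then have "0 = (\<Sum>K\<in>TT. lateral_integral UNIV K (\<lambda>\<eta> z. ((tr K u z - ub z) \<bullet> snd \<eta>) * qb z))"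
    using zero [of "((\<lambda>_. 0), qb)"] by (simp add: bh_def)
  also have "\<dots> = (\<Sum>K\<in>TT. if S \<in> lateral_facets K
      then LINT z|surface_measure S. indicator (rel_interior S) z * (g K z * G z) else 0)"
  proof (intro sum.cong refl)
    fix K assume K: "K \<in> TT"
    let ?I = "\<lambda>S'. LINT z:S' \<inter> UNIV|surface_measure S'.
      ((tr K u z - ub z) \<bullet> snd (unit_normal K S')) * qb z"
    have "?I S' = 0" if "S' \<in> lateral_facets K" "S' \<noteq> S" for S'
    proof -
      have "indicator S' z * (((tr K u z - ub z) \<bullet> snd (unit_normal K S')) * qb z) = 0" for z
        using off [OF K that] by (auto simp: indicator_def)
      then show ?thesis
        by (simp only: set_lebesgue_integral_def Int_UNIV_right real_scaleR_def
            Bochner_Integration.integral_zero)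
    qed
    then have "(\<Sum>S'\<in>lateral_facets K. ?I S') = (\<Sum>S'\<in>lateral_facets K. if S' = S then ?I S else 0)"
      by (intro sum.cong) auto
    also have "\<dots> = (if S \<in> lateral_facets K then ?I S else 0)"
      using slab_mesh_simplex(8) [OF m K] by simp
    also have "\<dots> = (if S \<in> lateral_facets K
      then LINT z|surface_measure S. indicator (rel_interior S) z * (g K z * G z) else 0)"
    proof (cases "S \<in> lateral_facets K")
      case True
      have "indicator S z * (((tr K u z - ub z) \<bullet> snd (unit_normal K S)) * qb z) =
        indicator (rel_interior S) z * (g K z * G z)" for z
        using g(2) [of K z] K True rel_interior_subset [of S] by (auto simp: qb_def indicator_def)
      then show ?thesis
        using True by (simp only: set_lebesgue_integral_def Int_UNIV_right real_scaleR_def if_True)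
    qed simp
    finally show "lateral_integral UNIV K (\<lambda>\<eta> z. ((tr K u z - ub z) \<bullet> snd \<eta>) * qb z) =
      (if S \<in> lateral_facets K
      then LINT z|surface_measure S. indicator (rel_interior S) z * (g K z * G z) else 0)"
      by (simp add: lateral_integral_def)
  qed
  also have "\<dots> = (\<Sum>K\<in>?N. LINT z|surface_measure S. indicator (rel_interior S) z * (g K z * G z))"
    using \<open>finite TT\<close> by (simp add: sum.inter_filter)
  also have "\<dots> = (LINT z|surface_measure S. (\<Sum>K\<in>?N. indicator (rel_interior S) z * (g K z * G z)))"
    using S0 g G
    by (intro Bochner_Integration.integral_sum [symmetric] surface_integrable continuous_intros
        polys_continuous_on compact_imp_bounded) auto
  also have "\<dots> = (LINT z|surface_measure S. indicator (rel_interior S) z * (G z)\<^sup>2)"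
  proof -
    have "(\<Sum>K\<in>?N. g K z * G z) = G z * G z" for z
      unfolding sum_distrib_right [symmetric] by (simp add: G_def)
    then show ?thesis by (simp only: sum_distrib_left [symmetric] power2_eq_square)
  qed
  finally have "G z = 0"
    using zero_of_surface_integral_square [OF S0(6,5) compact_imp_bounded [OF S0(3)]
        polys_continuous_on [OF G] _ z] by simp
  then show ?thesis using g(2) z by (simp add: G_def)
qed


text \<open>
  With opposite normals the two contributions of the facet velocity cancel, so the flux balance on
  the relative interior of \<open>S\<close> no longer involves \<open>ub\<close>.  The traces are continuous up to the
  relative boundary of \<open>S\<close>, which extends the identity to all of \<open>S\<close>.
\<close>

lemma normal_jump_zero:
  fixes u ub :: "'d::finite spacetime \<Rightarrow> real ^ 'd"
  assumes m: "slab_mesh E TT" and u: "u \<in> Vh k TT" and ub: "ub \<in> Vbarh k bD TT"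
    and zero: "\<And>Q. Q \<in> Xq k TT \<Longrightarrow> bh TT Q (u, ub) = 0"
    and S: "S \<in> mesh_facets TT"
    and K1: "K1 \<in> TT" "S facet_of K1" and K2: "K2 \<in> TT" "S facet_of K2" and "K1 \<noteq> K2"
    and z: "z \<in> S"
  shows "tr K1 u z \<bullet> snd (unit_normal K1 S) + tr K2 u z \<bullet> snd (unit_normal K2 S) = 0"
proof -
  have n: "unit_normal K2 S = - unit_normal K1 S"
    using shared_facet_opposite_normals [OF m K1 K2 \<open>K1 \<noteq> K2\<close>] .
  obtain K where K: "K \<in> TT" "S facet_of K" "\<bar>fst (unit_normal K S)\<bar> \<noteq> 1"
    using S by (auto simp: mesh_facets_def lateral_facets_def)
  then have "K = K1 \<or> K = K2"
    using facet_shared_by_at_most_two [OF m K1 K2 \<open>K1 \<noteq> K2\<close>] by blast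
  then have "\<bar>fst (unit_normal K1 S)\<bar> \<noteq> 1" using K(3) n by auto
  then have "S \<in> lateral_facets K1" "S \<in> lateral_facets K2"
    using K1 K2 n by (auto simp: lateral_facets_def)
  then have N: "{K \<in> TT. S \<in> lateral_facets K} = {K1, K2}"
    using K1 K2 facet_shared_by_at_most_two [OF m K1 K2 \<open>K1 \<noteq> K2\<close>]
    by (auto simp: lateral_facets_def)
  define J where "J = (\<lambda>z. tr K1 u z \<bullet> snd (unit_normal K1 S) + tr K2 u z \<bullet> snd (unit_normal K2 S))"
  have J0: "J w = 0" if "w \<in> rel_interior S" for w
    using facet_flux_balance [OF m u ub zero S that] \<open>K1 \<noteq> K2\<close>
    by (simp add: N J_def n inner_diff_left)
  have cont: "continuous_on S (\<lambda>z. tr K u z \<bullet> a)" if "K \<in> TT" "S facet_of K" for K a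
    using continuous_on_subset [OF trace_continuous_on [OF m that(1) u]] facet_of_imp_subset [OF that(2)]
    by (intro continuous_intros) blast
  have "continuous_on S J" unfolding J_def by (intro continuous_on_add cont K1 K2)
  note S1 = slab_mesh_facet [OF m K1]
  have "J z = 0"
    using continuous_constant_on_closure [of "rel_interior S" J 0 z] \<open>continuous_on S J\<close> J0 S1(7) z
    by simp
  then show ?thesis by (simp add: J_def)
qed

text \<open>
  A facet on the boundary of the slab has a single adjacent simplex, so the sum in the flux balance
  has just one term.
\<close>

lemma normal_trace_eq_facet_velocity:
  fixes u ub :: "'d::finite spacetime \<Rightarrow> real ^ 'd"
  assumes m: "slab_mesh E TT" and u: "u \<in> Vh k TT" and ub: "ub \<in> Vbarh k bD TT"
    and zero: "\<And>Q. Q \<in> Xq k TT \<Longrightarrow> bh TT Q (u, ub) = 0"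
    and S: "S \<in> boundary_facets E TT" and K: "K \<in> TT" "S facet_of K"
    and z: "z \<in> rel_interior S"
  shows "tr K u z \<bullet> snd (unit_normal K S) = ub z \<bullet> snd (unit_normal K S)"
proof -
  have S': "S \<in> mesh_facets TT" "S \<subseteq> frontier E"
    using S by (simp_all add: boundary_facets_def)
  have only: "K' = K" if "K' \<in> TT" "S facet_of K'" for K'
    using frontier_facet_not_shared [OF m that K S'(2)] .
  obtain K' where K': "K' \<in> TT" "S \<in> lateral_facets K'"
    using S'(1) by (auto simp: mesh_facets_def)
  then have "K' = K" using only by (simp add: lateral_facets_def)
  have "{K \<in> TT. S \<in> lateral_facets K} = {K}"
  proof
    show "{K \<in> TT. S \<in> lateral_facets K} \<subseteq> {K}"
      using only by (auto simp: lateral_facets_def)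
    show "{K} \<subseteq> {K \<in> TT. S \<in> lateral_facets K}"
      using K' \<open>K' = K\<close> by simp
  qed
  then show ?thesis
    using facet_flux_balance [OF m u ub zero S'(1) z] by (simp add: inner_diff_left)
qed

section \<open>Local mass conservation\<close>

theorem proposition1:
  fixes T \<nu> \<alpha> :: real
    and \<Omega> :: "real \<Rightarrow> (real ^ 'd::finite) set"
    and ED EN :: "'d spacetime set"
    and f g :: "'d spacetime \<Rightarrow> real ^ 'd"
    and u0 :: "real ^ 'd \<Rightarrow> real ^ 'd"
    and X :: "(real ^ 'd \<Rightarrow> real ^ 'd) set"
    and Proj :: "(real ^ 'd \<Rightarrow> real ^ 'd) \<Rightarrow> real ^ 'd \<Rightarrow> real ^ 'd"
    and N k n :: nat
    and \<tau> :: "nat \<Rightarrow> real"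
    and TT :: "nat \<Rightarrow> 'd spacetime set set"
    and h :: "'d spacetime set \<Rightarrow> real"
    and s :: variant
    and u ub :: "nat \<Rightarrow> 'd spacetime \<Rightarrow> real ^ 'd"
    and p pb :: "nat \<Rightarrow> 'd spacetime \<Rightarrow> real"
  assumes "CARD('d) = 2 \<or> CARD('d) = 3"
    and "0 < T" and "0 < \<nu>" and "0 < \<alpha>" and "1 \<le> k"
    and "moving_domain T \<Omega>"
    and "boundary_partition T \<Omega> ED EN"
    and "time_partition T N \<tau>"
    and "spacetime_mesh T \<Omega> N \<tau> TT"
    and "\<forall>m<N. \<forall>K\<in>TT m. 0 < h K"
    and "div_free (\<Omega> 0) u0"
    and "div_free_projection k (TT 0) (\<Omega> 0) X Proj" and "u0 \<in> X"
    and "n < N"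
    and "\<forall>m\<le>n. slab_solution s k \<nu> \<alpha> h f g
           (ED \<inter> slab_boundary T \<Omega> \<tau> m) (EN \<inter> slab_boundary T \<Omega> \<tau> m) (TT m)
           (\<Omega> (\<tau> m)) (\<tau> m) (u_minus \<tau> (Proj u0) u m) (u m, ub m) (p m, pb m)"
  shows "(\<forall>K\<in>TT n. (\<forall>z\<in>interior K. divg (u n) z = 0) \<and> (\<forall>z\<in>K. tr K (divg (u n)) z = 0)) \<and>
         (\<forall>S\<in>interior_facets (slab T \<Omega> \<tau> n) (TT n). \<forall>K1\<in>TT n. \<forall>K2\<in>TT n.
            K1 \<noteq> K2 \<and> S facet_of K1 \<and> S facet_of K2 \<longrightarrow>
            (\<forall>z\<in>S. tr K1 (u n) z \<bullet> snd (unit_normal K1 S) +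
                    tr K2 (u n) z \<bullet> snd (unit_normal K2 S) = 0)) \<and>
         (\<forall>S\<in>boundary_facets (slab T \<Omega> \<tau> n) (TT n). \<forall>K\<in>TT n. S facet_of K \<longrightarrow>
            (\<forall>z\<in>rel_interior S. tr K (u n) z \<bullet> snd (unit_normal K S) =
                                ub n z \<bullet> snd (unit_normal K S)))"
proof -
  let ?E = "slab T \<Omega> \<tau> n"
  have m: "slab_mesh ?E (TT n)"
    using \<open>spacetime_mesh T \<Omega> N \<tau> TT\<close> \<open>n < N\<close> unfolding spacetime_mesh_def by blast
  let ?bD = "ED \<inter> slab_boundary T \<Omega> \<tau> n"
  have "slab_solution s k \<nu> \<alpha> h f g ?bD (EN \<inter> slab_boundary T \<Omega> \<tau> n) (TT n)
      (\<Omega> (\<tau> n)) (\<tau> n) (u_minus \<tau> (Proj u0) u n) (u n, ub n) (p n, pb n)"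
    using assms(15) by blast
  then have U: "(u n, ub n) \<in> Xv s k ?bD (TT n)"
    and zero: "\<And>Q. Q \<in> Xq k (TT n) \<Longrightarrow> bh (TT n) Q (u n, ub n) = 0"
    unfolding slab_solution_def by blast+
  have u: "u n \<in> Vh k (TT n)" and ub: "ub n \<in> Vbarh k ?bD (TT n)"
    using U by (cases s; simp add: Xv_def)+
  have div: "divg (u n) z = 0" if "K \<in> TT n" "z \<in> interior K" for K z
    using divergence_free_of_continuity_equation [OF m u zero that] .
  have "tr K (divg (u n)) z = 0" if "K \<in> TT n" "z \<in> K" for K z
    by (rule trace_eq_continuous_extension [OF m that(1) continuous_on_const _ that(2)])
      (rule div [OF that(1)])
  moreover have "tr K1 (u n) z \<bullet> snd (unit_normal K1 S) + tr K2 (u n) z \<bullet> snd (unit_normal K2 S) = 0"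
    if "S \<in> interior_facets ?E (TT n)" "K1 \<in> TT n" "K2 \<in> TT n"
      "K1 \<noteq> K2 \<and> S facet_of K1 \<and> S facet_of K2" "z \<in> S" for S K1 K2 z
    using normal_jump_zero [OF m u ub zero, of S K1 K2 z] that by (simp add: interior_facets_def)
  moreover have "tr K (u n) z \<bullet> snd (unit_normal K S) = ub n z \<bullet> snd (unit_normal K S)"
    if "S \<in> boundary_facets ?E (TT n)" "K \<in> TT n" "S facet_of K" "z \<in> rel_interior S" for S K z
    using normal_trace_eq_facet_velocity [OF m u ub zero that] .
  ultimately show ?thesis using div by blast
qed

end
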